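(* Let $N:D_N\to L_2$ be a normal integral operator induced by a $K^0$-kernel $N(s,t)$ and having diagonal form $$ Nf=\sum_{n=1}^\infty\alpha_n\langle f,\varphi_n\rangle\varphi_n,\qquad f\in D_N, $$ where $\{\varphi_n\}_{n=1}^\infty\subset L_2$ is an orthonormal set, the numbers $\alpha_n\in\mathbb C$ ($n=1,2,3,\dots$) are in a sector of angle less than $\pi$ with vertex at $0$, and the series converges in the $L_2$-norm to $Nf$. Then the bilinear series $$ \sum_{n=1}^\infty\alpha_n\varphi_n(s)\overline{\varphi_n(t)} $$ converges both absolutely and uniformly in $\mathbb R_+^2$ to the kernel $N(s,t)$.
   Context: Notation: $\mathbb R_+=[0,\infty)$. $L_2$ is the Hilbert space of complex-valued measurable functions on $\mathbb R_+$ that are square integrable with respect to Lebesgue measure, with inner product $\langle f,g\rangle=\int_{\mathbb R_+}f(s)\overline{g(s)}\,ds$ and norm $\|f\|=\langle f,f\rangle^{1/2}$. Integral operators: a linear operator $T:D_T\to L_2$, with $D_T$ a dense linear manifold in $L_2$, is integral if there is a measurable, almost everywhere finite-valued function $K(s,t)$ on $\mathbb R_+^2$ (a kernel, which is said to induce $T$) such that for every $f\in D_T$, $(Tf)(s)=\int_{\mathbb R_+}K(s,t)f(t)\,dt$ for almost every $s\in\mathbb R_+$. A kernel is Carleman if $K(s,\cdot)\in L_2$ for almost every $s$; an integral operator induced by a Carleman kernel is a Carleman operator, and it is bi-Carleman if in addition $K(\cdot,t)\in L_2$ for almost every $t$. In the bi-Carleman case the kernel induces two Carleman functions from $\mathbb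 R_+$ to $L_2$, $k(s)=\overline{K(s,\cdot)}$ and $k^*(t)=K(\cdot,t)$, for all $s,t$ for which $K(s,\cdot)\in L_2$ and $K(\cdot,t)\in L_2$. For a locally compact space $X$ and a Banach space $B$, $C(X,B)$ is the Banach space of all continuous functions $f:X\to B$ vanishing at infinity (for every $\varepsilon>0$ there is a compact set in $X$ outside of which $\|f(x)\|_B<\varepsilon$), with norm $\sup_{x\in X}\|f(x)\|_B$. A kernel $K$ of a bi-Carleman operator is a $K^0$-kernel if $K\in C(\mathbb R_+^2,\mathbb C)$ and its Carleman functions satisfy $k,k^*\in C(\mathbb R_+,L_2)$. A normal operator $N:D_N\to L_2$ is a (possibly unbounded) closed linear operator with domain $D_N=D_{N^*}$ dense in $L_2$ and $NN^*=N^*N$. A sector of angle less than $\pi$ with vertex at $0$ is a set $\{re^{i\theta}: r\ge 0,\ \theta_1\le\theta\le\theta_2\}$ with $\theta_2-\theta_1<\pi$. Convention: the $\varphi_n$ are elements of $L_2$, i.e. equivalence classes. For $\alpha_n\neq 0$, the class of $\varphi_n=\alpha_n^{-1}N\varphi_n$ contains a unique continuous function, and in the bilinear series $\varphi_n$ denotes this continuous representative; terms with $\alpha_n=0$ are zero. *)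

theory Defs
  imports "HOL-Analysis.Analysis"
begin

section \<open>The space of square integrable complex functions on the half-line\<close>

definition sq_integrable :: "(real \<Rightarrow> complex) \<Rightarrow> bool" where
  "sq_integrable f \<longleftrightarrow>
     f \<in> borel_measurable (lebesgue_on {0..}) \<and>
     integrable (lebesgue_on {0..}) (\<lambda>x. (cmod (f x))\<^sup>2)"

definition L2_rel :: "(real \<Rightarrow> complex) \<Rightarrow> (real \<Rightarrow> complex) \<Rightarrow> bool" where
  "L2_rel f g \<longleftrightarrow>
     sq_integrable f \<and> sq_integrable g \<and> (AE x in lebesgue_on {0..}. f x = g x)"

lemma sq_integrable_zero: "sq_integrable (\<lambda>x. 0)"
  by (simp add: sq_integrable_def)

lemma sq_integrable_mult_left:
  assumes "sq_integrable f"
  shows "sq_integrable (\<lambda>x. c * f x)"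
proof -
  have "integrable (lebesgue_on {0..}) (\<lambda>x. (cmod c)\<^sup>2 * (cmod (f x))\<^sup>2)"
    using assms by (auto simp: sq_integrable_def)
  then show ?thesis
    using assms by (auto simp: sq_integrable_def norm_mult power_mult_distrib)
qed

lemma sq_integrable_add:
  assumes "sq_integrable f" "sq_integrable g"
  shows "sq_integrable (\<lambda>x. f x + g x)"
proof -
  have [measurable]: "f \<in> borel_measurable (lebesgue_on {0..})"
    "g \<in> borel_measurable (lebesgue_on {0..})"
    using assms by (auto simp: sq_integrable_def)
  have bound: "(cmod (a + b))\<^sup>2 \<le> 2 * (cmod a)\<^sup>2 + 2 * (cmod b)\<^sup>2" for a b
  proof -
    have "(cmod (a + b))\<^sup>2 \<le> (cmod a + cmod b)\<^sup>2"
      by (intro power_mono norm_triangle_ineq) auto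
    also have "\<dots> \<le> 2 * (cmod a)\<^sup>2 + 2 * (cmod b)\<^sup>2"
      using sum_squares_bound[of "cmod a" "cmod b"] by (simp add: power2_sum)
    finally show ?thesis .
  qed
  have "integrable (lebesgue_on {0..}) (\<lambda>x. 2 * (cmod (f x))\<^sup>2 + 2 * (cmod (g x))\<^sup>2)"
    using assms by (auto simp: sq_integrable_def)
  then have "integrable (lebesgue_on {0..}) (\<lambda>x. (cmod (f x + g x))\<^sup>2)"
    by (rule Bochner_Integration.integrable_bound) (use bound in auto)
  then show ?thesis
    by (simp add: sq_integrable_def)
qed

lemma sq_integrable_uminus: "sq_integrable f \<Longrightarrow> sq_integrable (\<lambda>x. - f x)"
  using sq_integrable_mult_left[of f "-1"] by simp

lemma sq_integrable_diff:
  "sq_integrable f \<Longrightarrow> sq_integrable g \<Longrightarrow> sq_integrable (\<lambda>x. f x - g x)"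
  using sq_integrable_add[OF _ sq_integrable_uminus, of f g] by simp

lemma integrable_mult_cnj:
  assumes "sq_integrable f" "sq_integrable g"
  shows "integrable (lebesgue_on {0..}) (\<lambda>x. f x * cnj (g x))"
proof -
  have [measurable]: "f \<in> borel_measurable (lebesgue_on {0..})"
    "g \<in> borel_measurable (lebesgue_on {0..})"
    using assms by (auto simp: sq_integrable_def)
  have bound: "cmod (a * cnj b) \<le> (cmod a)\<^sup>2 + (cmod b)\<^sup>2" for a b
  proof -
    have "0 \<le> cmod a * cmod b" "cmod (a * cnj b) = cmod a * cmod b"
      by (simp_all add: norm_mult)
    then show ?thesis
      using sum_squares_bound[of "cmod a" "cmod b"] by linarith
  qed
  have m: "(\<lambda>x. f x * cnj (g x)) \<in> borel_measurable (lebesgue_on {0..})"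
    by (intro borel_measurable_times borel_measurable_continuous_on[where f = cnj]
        continuous_intros) auto
  have "integrable (lebesgue_on {0..}) (\<lambda>x. (cmod (f x))\<^sup>2 + (cmod (g x))\<^sup>2)"
    using assms by (auto simp: sq_integrable_def)
  then show ?thesis
    by (rule Bochner_Integration.integrable_bound) (use bound m in auto)
qed

quotient_type L2 = "real \<Rightarrow> complex" / partial: L2_rel
  morphisms rep_L2 abs_L2
proof (rule part_equivpI)
  show "\<exists>f. L2_rel f f"
    using sq_integrable_zero by (auto simp: L2_rel_def)
  show "symp L2_rel"
    by (auto intro!: sympI simp: L2_rel_def)
  show "transp L2_rel"
    by (auto intro!: transpI simp: L2_rel_def)
qed

text \<open>The inner product is linear in the first argument.\<close>

lift_definition cinner :: "L2 \<Rightarrow> L2 \<Rightarrow> complex"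
  is "\<lambda>f g. integral\<^sup>L (lebesgue_on {0..}) (\<lambda>x. f x * cnj (g x))"
proof -
  fix f f' g g'
  assume a: "L2_rel f f'" "L2_rel g g'"
  then have "AE x in lebesgue_on {0..}. f x * cnj (g x) = f' x * cnj (g' x)"
    by (auto simp: L2_rel_def)
  moreover have "(\<lambda>x. f x * cnj (g x)) \<in> borel_measurable (lebesgue_on {0..})"
    "(\<lambda>x. f' x * cnj (g' x)) \<in> borel_measurable (lebesgue_on {0..})"
    using a by (auto simp: L2_rel_def intro!: borel_measurable_integrable integrable_mult_cnj)
  ultimately show "(LINT x|lebesgue_on {0..}. f x * cnj (g x)) =
      (LINT x|lebesgue_on {0..}. f' x * cnj (g' x))"
    by (intro integral_cong_AE)
qed

lift_definition scaleC :: "complex \<Rightarrow> L2 \<Rightarrow> L2"  (infixr "*\<^sub>C" 75)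
  is "\<lambda>c f x. c * f x"
  by (auto simp: L2_rel_def sq_integrable_mult_left)

text \<open>The real inner product is the real part of the complex one; it induces the usual norm
  and hence the usual topology.\<close>

instantiation L2 :: real_inner
begin

lift_definition zero_L2 :: L2 is "\<lambda>x. 0"
  by (simp add: L2_rel_def sq_integrable_zero)

lift_definition plus_L2 :: "L2 \<Rightarrow> L2 \<Rightarrow> L2" is "\<lambda>f g x. f x + g x"
  by (auto simp: L2_rel_def sq_integrable_add)

lift_definition minus_L2 :: "L2 \<Rightarrow> L2 \<Rightarrow> L2" is "\<lambda>f g x. f x - g x"
  by (auto simp: L2_rel_def sq_integrable_diff)

lift_definition uminus_L2 :: "L2 \<Rightarrow> L2" is "\<lambda>f x. - f x"
  by (auto simp: L2_rel_def sq_integrable_uminus)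

definition scaleR_L2 :: "real \<Rightarrow> L2 \<Rightarrow> L2" where
  "scaleR_L2 r f = of_real r *\<^sub>C f"

definition inner_L2 :: "L2 \<Rightarrow> L2 \<Rightarrow> real" where
  "inner_L2 f g = Re (cinner f g)"

definition norm_L2 :: "L2 \<Rightarrow> real" where
  "norm_L2 f = sqrt (inner f f)"

definition dist_L2 :: "L2 \<Rightarrow> L2 \<Rightarrow> real" where
  "dist_L2 f g = norm (f - g)"

definition sgn_L2 :: "L2 \<Rightarrow> L2" where
  "sgn_L2 f = inverse (norm f) *\<^sub>R f"

definition uniformity_L2 :: "(L2 \<times> L2) filter" where
  "uniformity_L2 = (INF e\<in>{0<..}. principal {(x, y). dist x y < e})"

definition open_L2 :: "L2 set \<Rightarrow> bool" where
  "open_L2 U \<longleftrightarrow> (\<forall>x\<in>U. eventually (\<lambda>(x', y). x' = x \<longrightarrow> y \<in> U) uniformity)"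

lemma cinner_add_left: "cinner (f + g) h = cinner f h + cinner g h"
  by transfer
    (simp add: L2_rel_def distrib_right integrable_mult_cnj)

lemma cinner_scaleC_left: "cinner (c *\<^sub>C f) g = c * cinner f g"
  by transfer (simp add: mult.assoc)

lemma cinner_commute: "cinner f g = cnj (cinner g f)"
  by transfer (simp add: mult.commute flip: Bochner_Integration.integral_cnj)

lemma cinner_self:
  "cinner f f = of_real (LINT x|lebesgue_on {0..}. (cmod (rep_L2 f x))\<^sup>2)"
  by (simp add: cinner.rep_eq complex_norm_square[symmetric] flip: of_real_power)

lemma cinner_self_eq_0: "Re (cinner f f) = 0 \<longleftrightarrow> f = 0"
proof -
  have "Re (LINT x|lebesgue_on {0..}. g x * cnj (g x)) = 0 \<longleftrightarrow> L2_rel g (\<lambda>x. 0)"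
    if "L2_rel g g" for g
  proof -
    have sq: "sq_integrable g"
      using that by (simp add: L2_rel_def)
    then have i: "integrable (lebesgue_on {0..}) (\<lambda>x. (cmod (g x))\<^sup>2)"
      by (simp add: sq_integrable_def)
    have "(LINT x|lebesgue_on {0..}. g x * cnj (g x)) =
        of_real (LINT x|lebesgue_on {0..}. (cmod (g x))\<^sup>2)"
      by (simp add: complex_norm_square[symmetric] flip: of_real_power)
    then show ?thesis
      using integral_nonneg_eq_0_iff_AE[OF i] sq sq_integrable_zero
      by (simp add: L2_rel_def)
  qed
  then show ?thesis
    by transfer simp
qed

instance
proof
  fix f g h :: L2 and a b r :: real
  show "f + g + h = f + (g + h)"
    by transfer (simp add: L2_rel_def add.assoc sq_integrable_add)
  show "f + g = g + f"
    by transfer (simp add: L2_rel_def add.commute sq_integrable_add)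
  show "0 + f = f"
    by transfer (simp add: L2_rel_def)
  show "- f + f = 0"
    by transfer (simp add: L2_rel_def sq_integrable_zero)
  show "f - g = f + - g"
    by transfer (simp add: L2_rel_def sq_integrable_diff)
  show "a *\<^sub>R (f + g) = a *\<^sub>R f + a *\<^sub>R g"
    unfolding scaleR_L2_def
    by transfer (auto simp: L2_rel_def distrib_left
        intro!: sq_integrable_add sq_integrable_mult_left)
  show "(a + b) *\<^sub>R f = a *\<^sub>R f + b *\<^sub>R f"
    unfolding scaleR_L2_def
    by transfer (auto simp: L2_rel_def distrib_right
        intro!: sq_integrable_add sq_integrable_mult_left)
  show "a *\<^sub>R b *\<^sub>R f = (a * b) *\<^sub>R f"
    unfolding scaleR_L2_def
    by transfer (auto simp: L2_rel_def mult.assoc intro!: sq_integrable_mult_left)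
  show "1 *\<^sub>R f = f"
    unfolding scaleR_L2_def by transfer (simp add: L2_rel_def)
  show "dist f g = norm (f - g)"
    by (rule dist_L2_def)
  show "sgn f = inverse (norm f) *\<^sub>R f"
    by (rule sgn_L2_def)
  show "uniformity = (INF e\<in>{0<..}. principal {(x :: L2, y). dist x y < e})"
    by (rule uniformity_L2_def)
  show "open U \<longleftrightarrow> (\<forall>x\<in>U. \<forall>\<^sub>F (x', y) in uniformity. x' = x \<longrightarrow> y \<in> U)" for U :: "L2 set"
    by (rule open_L2_def)
  show "f \<bullet> g = g \<bullet> f"
    unfolding inner_L2_def by (subst cinner_commute) simp
  show "(f + g) \<bullet> h = f \<bullet> h + g \<bullet> h"
    by (simp add: inner_L2_def cinner_add_left)
  show "r *\<^sub>R f \<bullet> g = r * (f \<bullet> g)"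
    by (simp add: inner_L2_def scaleR_L2_def cinner_scaleC_left)
  show "0 \<le> f \<bullet> f"
    by (simp add: inner_L2_def cinner_self)
  show "f \<bullet> f = 0 \<longleftrightarrow> f = 0"
    by (simp add: inner_L2_def cinner_self_eq_0)
  show "norm f = sqrt (f \<bullet> f)"
    by (rule norm_L2_def)
qed

end

definition orthonormal :: "(nat \<Rightarrow> L2) \<Rightarrow> bool" where
  "orthonormal \<phi> \<longleftrightarrow> (\<forall>m n. cinner (\<phi> m) (\<phi> n) = (if m = n then 1 else 0))"

text \<open>Functions are total in HOL, so the values off the half-line are set to 0 to make the
  continuous representative unique.\<close>

definition cont_rep :: "L2 \<Rightarrow> real \<Rightarrow> complex" where
  "cont_rep f = (THE g. sq_integrable g \<and> abs_L2 g = f \<and> continuous_on {0..} g \<and> (\<forall>x<0. g x = 0))"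


section \<open>Continuous functions vanishing at infinity\<close>

definition C0 :: "'a::topological_space set \<Rightarrow> ('a \<Rightarrow> 'b::real_normed_vector) set" where
  "C0 X = {f. continuous_on X f \<and>
     (\<forall>\<epsilon>>0. \<exists>C. compact C \<and> C \<subseteq> X \<and> (\<forall>x\<in>X - C. norm (f x) < \<epsilon>))}"


section \<open>Unbounded operators\<close>

text \<open>An operator is a partial map; its domain is \<^term>\<open>dom T\<close>, and the product of two
  operators, with its natural domain, is \<^term>\<open>S \<circ>\<^sub>m T\<close>.\<close>

type_synonym op_L2 = "L2 \<rightharpoonup> L2"

definition linear_op :: "op_L2 \<Rightarrow> bool" where
  "linear_op T \<longleftrightarrow> T 0 = Some 0 \<and>
     (\<forall>f g u v. T f = Some u \<longrightarrow> T g = Some v \<longrightarrow> T (f + g) = Some (u + v)) \<and>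
     (\<forall>c f u. T f = Some u \<longrightarrow> T (c *\<^sub>C f) = Some (c *\<^sub>C u))"

definition densely_defined :: "op_L2 \<Rightarrow> bool" where
  "densely_defined T \<longleftrightarrow> closure (dom T) = UNIV"

definition closed_op :: "op_L2 \<Rightarrow> bool" where
  "closed_op T \<longleftrightarrow> closed {(f, u). T f = Some u}"

text \<open>For densely defined operators the vector \<open>h\<close> below is unique as soon as it exists.\<close>

definition adjoint_op :: "op_L2 \<Rightarrow> op_L2" where
  "adjoint_op T = (\<lambda>g.
     if \<exists>!h. \<forall>f u. T f = Some u \<longrightarrow> cinner u g = cinner f h
     then Some (THE h. \<forall>f u. T f = Some u \<longrightarrow> cinner u g = cinner f h)
     else None)"

definition normal_op :: "op_L2 \<Rightarrow> bool" where
  "normal_op T \<longleftrightarrow> linear_op T \<and> densely_defined T \<and> closed_op T \<and>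
     dom T = dom (adjoint_op T) \<and> T \<circ>\<^sub>m adjoint_op T = adjoint_op T \<circ>\<^sub>m T"


section \<open>Kernels and integral operators\<close>

text \<open>Only the values on \<open>{0..} \<times> {0..}\<close> matter. Finiteness of the values is built into the
  type \<^typ>\<open>complex\<close>.\<close>

type_synonym kernel = "real \<Rightarrow> real \<Rightarrow> complex"

definition measurable_kernel :: "kernel \<Rightarrow> bool" where
  "measurable_kernel K \<longleftrightarrow>
     (\<lambda>(s, t). K s t) \<in> borel_measurable (lebesgue_on ({0..} \<times> {0..}))"

text \<open>Integrability is required explicitly because the integral of a non-integrable function
  is 0 by convention. The choice of the representatives does not matter.\<close>

definition induces :: "kernel \<Rightarrow> op_L2 \<Rightarrow> bool" where
  "induces K T \<longleftrightarrow> measurable_kernel K \<and> linear_op T \<and> densely_defined T \<and>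
     (\<forall>f u. T f = Some u \<longrightarrow>
        (AE s in lebesgue_on {0..}.
           integrable (lebesgue_on {0..}) (\<lambda>t. K s t * rep_L2 f t) \<and>
           rep_L2 u s = (LINT t|lebesgue_on {0..}. K s t * rep_L2 f t)))"

definition carleman_kernel :: "kernel \<Rightarrow> bool" where
  "carleman_kernel K \<longleftrightarrow>
     measurable_kernel K \<and> (AE s in lebesgue_on {0..}. sq_integrable (\<lambda>t. K s t))"

definition bi_carleman_kernel :: "kernel \<Rightarrow> bool" where
  "bi_carleman_kernel K \<longleftrightarrow>
     carleman_kernel K \<and> (AE t in lebesgue_on {0..}. sq_integrable (\<lambda>s. K s t))"

text \<open>The two Carleman functions are meaningful only at points where the respective section of
  the kernel is square integrable.\<close>

definition carleman_fun :: "kernel \<Rightarrow> real \<Rightarrow> L2" where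
  "carleman_fun K s = abs_L2 (\<lambda>t. cnj (K s t))"

definition carleman_fun_adj :: "kernel \<Rightarrow> real \<Rightarrow> L2" where
  "carleman_fun_adj K t = abs_L2 (\<lambda>s. K s t)"

definition K0_kernel :: "kernel \<Rightarrow> op_L2 \<Rightarrow> bool" where
  "K0_kernel K T \<longleftrightarrow> bi_carleman_kernel K \<and> induces K T \<and>
     (\<lambda>(s, t). K s t) \<in> C0 ({0..} \<times> {0..}) \<and>
     (\<forall>s\<ge>0. sq_integrable (\<lambda>t. K s t)) \<and> carleman_fun K \<in> C0 {0..} \<and>
     (\<forall>t\<ge>0. sq_integrable (\<lambda>s. K s t)) \<and> carleman_fun_adj K \<in> C0 {0..}"


section \<open>Sectors\<close>

definition sector :: "real \<Rightarrow> real \<Rightarrow> complex set" where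
  "sector \<theta>\<^sub>1 \<theta>\<^sub>2 = {of_real r * cis \<theta> | r \<theta>. 0 \<le> r \<and> \<theta>\<^sub>1 \<le> \<theta> \<and> \<theta> \<le> \<theta>\<^sub>2}"

end

theory Submission
  imports Defs
begin

section \<open>Bilinear expansion of sectorial normal integral operators\<close>

text \<open>Pairing the diagonal form with a vector \<open>\<phi>\<^sub>n\<close> shows that \<open>\<phi>\<^sub>n\<close> lies in the domain of the
  adjoint, which by normality is the domain of \<open>N\<close>; hence \<open>N \<phi>\<^sub>n = \<alpha>\<^sub>n \<phi>\<^sub>n\<close>. In the same way, Fubini's
  theorem puts the indicators of bounded intervals into the domain of \<open>N\<close>, so the diagonal form
  yields the expansion of the integral of the kernel over every bounded rectangle.

  From there the argument is that of Mercer. After a rotation the numbers \<open>Re (\<omega> \<alpha>\<^sub>n)\<close> are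
  nonnegative and comparable to \<open>|\<alpha>\<^sub>n|\<close>. Shrinking squares to a diagonal point bounds
  \<open>\<Sum> Re (\<omega> \<alpha>\<^sub>n) |\<phi>\<^sub>n(s)|\<^sup>2\<close> by \<open>Re (\<omega> K(s, s))\<close>, and the Cauchy-Schwarz inequality gives absolute
  convergence, uniform in each variable separately. The sum is therefore separately continuous and
  has the same integrals over rectangles as the kernel, so it is the kernel. On the diagonal, Dini's
  theorem and the decay at infinity now give uniform convergence, and Cauchy-Schwarz transfers it
  to the whole quadrant.\<close>

subsection \<open>Uniform convergence of series\<close>

text \<open>The integral from \<open>x\<close> to \<open>u\<close> has derivative \<open>g x\<close>
  at \<open>u = x\<close>, yet it vanishes identically on \<open>{x..x + 1}\<close>. A one-sided
  interval is taken because \<open>x\<close> may be the endpoint 0.\<close>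

lemma continuous_zero_if_integrals_zero:
  fixes g :: "real \<Rightarrow> 'a::banach"
  assumes cont: "continuous_on {0..} g"
    and int: "\<And>a b. 0 \<le> a \<Longrightarrow> a < b \<Longrightarrow> integral {a..b} g = 0"
    and x: "0 \<le> x"
  shows "g x = 0"
proof -
  have "((\<lambda>u. integral {x..u} g) has_vector_derivative g x) (at x within {x..x + 1})"
    using x by (intro integral_has_vector_derivative continuous_on_subset[OF cont]) auto
  moreover have "((\<lambda>u. integral {x..u} g) has_vector_derivative 0) (at x within {x..x + 1})"
  proof (rule has_vector_derivative_transform)
    show "integral {x..u} g = 0" if "u \<in> {x..x + 1}" for u
      using that int[OF x, of u] by (cases "u = x") auto
  qed auto
  ultimately show ?thesis
    using vector_derivative_unique_within_closed_interval[of x "x + 1" x]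
    unfolding cbox_interval by simp
qed

text \<open>The sets \<open>C n\<close> where the gap to the limit is at least \<open>e\<close> are
  compact and decreasing. A common point would contradict pointwise convergence, so one of them is
  empty.\<close>

lemma Dini_uniform_limit:
  fixes f :: "nat \<Rightarrow> 'a::heine_borel \<Rightarrow> real"
  assumes S: "compact S" and f: "\<And>n. continuous_on S (f n)" and g: "continuous_on S g"
    and mono: "\<And>x. x \<in> S \<Longrightarrow> incseq (\<lambda>n. f n x)"
    and lim: "\<And>x. x \<in> S \<Longrightarrow> (\<lambda>n. f n x) \<longlonglongrightarrow> g x"
  shows "uniform_limit S f g sequentially"
proof (rule uniform_limitI)
  fix e :: real assume e: "0 < e"
  have le: "f n x \<le> g x" if "x \<in> S" for n x
    using incseq_le[OF mono lim] that by blast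
  define C where "C n = {x \<in> S. e \<le> g x - f n x}" for n
  have comp: "compact (C n)" for n
  proof -
    have "closedin (top_of_set S) (S \<inter> (\<lambda>x. g x - f n x) -` {e..})"
      by (intro continuous_closedin_preimage continuous_intros f g)
    moreover have "S \<inter> (\<lambda>x. g x - f n x) -` {e..} = C n"
      by (auto simp: C_def)
    ultimately show ?thesis
      using closedin_compact S by metis
  qed
  have anti: "C n \<subseteq> C m" if "m \<le> n" for m n
    using incseqD[OF mono that] by (force simp: C_def)
  have "\<exists>n. C n = {}"
  proof (rule ccontr)
    assume "\<nexists>n. C n = {}"
    then have "\<Inter>(range C) \<noteq> {}"
      using comp anti compact_nest[of C] by blast
    then obtain x where x: "\<And>n. x \<in> C n" by auto
    then have "x \<in> S" by (auto simp: C_def)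
    then have "\<forall>\<^sub>F n in sequentially. dist (f n x) (g x) < e"
      using tendstoD[OF lim e] by blast
    then obtain n where "dist (f n x) (g x) < e"
      by (auto simp: eventually_sequentially)
    then show False
      using x[of n] by (auto simp: C_def dist_real_def)
  qed
  then obtain N where "C N = {}" by auto
  then have "C n = {}" if "N \<le> n" for n
    using anti[OF that] by auto
  then have "dist (f n x) (g x) < e" if "N \<le> n" "x \<in> S" for n x
    using that le[of x n] by (fastforce simp: C_def dist_real_def)
  then show "\<forall>\<^sub>F n in sequentially. \<forall>x\<in>S. dist (f n x) (g x) < e"
    by (auto simp: eventually_sequentially)
qed

text \<open>Cauchy-Schwarz on the blocks \<open>m..<n\<close>: a uniformly small tail in one
  variable is multiplied by a bounded sum in the other. The roles of \<open>p\<close> and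
  \<open>q\<close> are asymmetric so that uniform convergence of squares is demanded in one variable
  only.\<close>

lemma uniformly_convergent_bilinear_series:
  fixes u :: "nat \<Rightarrow> 'a \<Rightarrow> 'b \<Rightarrow> complex"
  assumes bound: "\<And>n s t. s \<in> X \<Longrightarrow> t \<in> Y \<Longrightarrow> cmod (u n s t) \<le> p n s * q n t"
    and nonneg: "\<And>n s. 0 \<le> p n s" "\<And>n t. 0 \<le> q n t"
    and unif: "uniformly_convergent_on X (\<lambda>m s. \<Sum>n<m. (p n s)\<^sup>2)"
    and bdd: "\<And>m t. t \<in> Y \<Longrightarrow> (\<Sum>n<m. (q n t)\<^sup>2) \<le> B"
  shows "uniformly_convergent_on (X \<times> Y) (\<lambda>m (s, t). \<Sum>n<m. u n s t)"
proof (intro Cauchy_uniformly_convergent uniformly_Cauchy_onI')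
  fix e :: real assume e: "0 < e"
  \<comment> \<open>The maximum with 1 keeps the divisor in \<open>e\<^sup>2 / C\<close> positive
    when \<open>B\<close> is 0.\<close>
  define C where "C = max B 1"
  have C: "0 < C" "B \<le> C" by (auto simp: C_def)
  have "0 < e\<^sup>2 / C" using e C by simp
  then have "\<exists>M. \<forall>s\<in>X. \<forall>m\<ge>M. \<forall>n\<ge>M.
      dist (\<Sum>i<m. (p i s)\<^sup>2) (\<Sum>i<n. (p i s)\<^sup>2) < e\<^sup>2 / C"
    using uniformly_convergent_Cauchy[OF unif] by (simp add: uniformly_Cauchy_on_def)
  then obtain M where M: "\<And>s m n. s \<in> X \<Longrightarrow> M \<le> m \<Longrightarrow> M \<le> n \<Longrightarrow>
      dist (\<Sum>i<m. (p i s)\<^sup>2) (\<Sum>i<n. (p i s)\<^sup>2) < e\<^sup>2 / C"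
    by blast
  show "\<exists>M. \<forall>z\<in>X \<times> Y. \<forall>m\<ge>M. \<forall>n>m.
      dist (case z of (s, t) \<Rightarrow> \<Sum>n<m. u n s t) (case z of (s, t) \<Rightarrow> \<Sum>i<n. u i s t) < e"
  proof (intro exI ballI allI impI, clarify)
    fix s t m n assume st: "s \<in> X" "t \<in> Y" and mn: "M \<le> m" "m < n"
    have split: "(\<Sum>i<n. h i) = (\<Sum>i<m. h i) + (\<Sum>i=m..<n. h i)"
      for h :: "nat \<Rightarrow> 'c::comm_monoid_add"
      using sum.atLeastLessThan_concat[of 0 m n h] mn by (simp add: lessThan_atLeast0)
    have P: "(\<Sum>i=m..<n. (p i s)\<^sup>2) < e\<^sup>2 / C"
      using M[OF st(1), of m n] mn by (simp add: dist_real_def split sum_nonneg)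
    have Q: "(\<Sum>i=m..<n. (q i t)\<^sup>2) \<le> C"
      using bdd[OF st(2), of n] C(2) split[of "\<lambda>i. (q i t)\<^sup>2"]
        sum_nonneg[of "{..<m}" "\<lambda>i. (q i t)\<^sup>2"] by simp
    have "cmod (\<Sum>i=m..<n. u i s t) \<le> (\<Sum>i=m..<n. p i s * q i t)"
      using bound[OF st] by (intro sum_norm_le) auto
    then have "(cmod (\<Sum>i=m..<n. u i s t))\<^sup>2 \<le> (\<Sum>i=m..<n. p i s * q i t)\<^sup>2"
      by (intro power_mono) auto
    also have "\<dots> \<le> (\<Sum>i=m..<n. (p i s)\<^sup>2) * (\<Sum>i=m..<n. (q i t)\<^sup>2)"
      by (rule Cauchy_Schwarz_ineq_sum)
    also have "\<dots> \<le> (\<Sum>i=m..<n. (p i s)\<^sup>2) * C"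
      using Q by (intro mult_left_mono sum_nonneg) auto
    also have "\<dots> < e\<^sup>2"
      using P C by (simp add: pos_less_divide_eq)
    finally have "cmod (\<Sum>i=m..<n. u i s t) < e"
      using e by (simp add: power2_less_imp_less)
    then show "dist (\<Sum>i<m. u i s t) (\<Sum>i<n. u i s t) < e"
      by (simp add: dist_norm split)
  qed
qed

text \<open>Dominated convergence along sequences, with the constant \<open>B\<close> as majorant,
  makes separate continuity sufficient. The application is to the difference of the kernel and the
  bilinear sum, whose joint continuity is not yet known at that stage.\<close>

lemma continuous_on_integral_separately_continuous:
  fixes E :: "real \<Rightarrow> real \<Rightarrow> complex"
  assumes 1: "\<And>t. t \<in> {c..d} \<Longrightarrow> continuous_on S (\<lambda>s. E s t)"
    and 2: "\<And>s. s \<in> S \<Longrightarrow> continuous_on {c..d} (E s)"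
    and bdd: "\<And>s t. s \<in> S \<Longrightarrow> t \<in> {c..d} \<Longrightarrow> cmod (E s t) \<le> B"
  shows "continuous_on S (\<lambda>s. integral {c..d} (E s))"
  unfolding continuous_on_sequentially comp_def
proof (intro allI ballI impI, elim conjE)
  fix x s assume s: "s \<in> S" and x: "\<forall>n. x n \<in> S" and lim: "x \<longlonglongrightarrow> s"
  show "(\<lambda>n. integral {c..d} (E (x n))) \<longlonglongrightarrow> integral {c..d} (E s)"
  proof (rule dominated_convergence)
    show "E (x n) integrable_on {c..d}" for n
      using 2 x by (intro integrable_continuous_interval) auto
    show "(\<lambda>n. E (x n) t) \<longlonglongrightarrow> E s t" if "t \<in> {c..d}" for t
      using 1[OF that] s x lim unfolding continuous_on_sequentially comp_def by blast
  qed (use bdd x in auto)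
qed

lemma sum_le_sums_nonneg:
  fixes f :: "nat \<Rightarrow> real"
  assumes "f sums S" "\<And>n. 0 \<le> f n"
  shows "(\<Sum>n<m. f n) \<le> S"
  using assms sum_le_suminf[of f "{..<m}"] by (auto simp: sums_iff)

lemma Re_mult_norm_square: "Re (w * (a * z * cnj z)) = Re (w * a) * (cmod z)\<^sup>2"
  unfolding cmod_power2 by (simp add: power2_eq_square algebra_simps)

section \<open>Functions vanishing at infinity\<close>

lemma C0_D:
  assumes "f \<in> C0 X" "0 < e"
  obtains C where "compact C" "C \<subseteq> X" "\<And>x. x \<in> X - C \<Longrightarrow> norm (f x) < e"
  using assms by (auto simp: C0_def)

lemma C0_continuous: "f \<in> C0 X \<Longrightarrow> continuous_on X f"
  by (simp add: C0_def)

lemma C0_bounded: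
  assumes "f \<in> C0 X"
  obtains B where "\<And>x. x \<in> X \<Longrightarrow> norm (f x) \<le> B"
proof -
  obtain C where C: "compact C" "C \<subseteq> X" "\<And>x. x \<in> X - C \<Longrightarrow> norm (f x) < 1"
    using C0_D[OF assms zero_less_one] by blast
  have "continuous_on C f"
    using C0_continuous[OF assms] C(2) by (rule continuous_on_subset)
  then have "bounded (f ` C)"
    using C(1) compact_continuous_image compact_imp_bounded by blast
  then obtain b where b: "\<And>x. x \<in> C \<Longrightarrow> norm (f x) \<le> b"
    by (auto simp: bounded_iff)
  then have "norm (f x) \<le> max b 1" if "x \<in> X" for x
    using C(3)[of x] b[of x] that by (cases "x \<in> C") (auto simp: le_max_iff_disj less_imp_le)
  then show ?thesis by (rule that)
qed

text \<open>Dini's theorem handles the compact set outside of which \<open>g\<close> is below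
  \<open>e\<close>. Off that set the partial sums lie between 0 and \<open>g\<close>, so the error
  is below \<open>e\<close> for every \<open>m\<close> at once.\<close>

lemma uniform_limit_nonneg_series_C0:
  fixes a :: "nat \<Rightarrow> 'a::heine_borel \<Rightarrow> real"
  assumes cont: "\<And>n. continuous_on X (a n)" and nonneg: "\<And>n s. 0 \<le> a n s"
    and g: "g \<in> C0 X"
    and sums: "\<And>s. s \<in> X \<Longrightarrow> (\<lambda>n. a n s) sums g s"
  shows "uniform_limit X (\<lambda>m s. \<Sum>n<m. a n s) g sequentially"
proof (rule uniform_limitI)
  fix e :: real assume e: "0 < e"
  obtain C where C: "compact C" "C \<subseteq> X" "\<And>x. x \<in> X - C \<Longrightarrow> norm (g x) < e"
    using C0_D[OF g e] by blast
  have "uniform_limit C (\<lambda>m s. \<Sum>n<m. a n s) g sequentially"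
  proof (rule Dini_uniform_limit)
    show "continuous_on C (\<lambda>s. \<Sum>n<m. a n s)" for m
      by (intro continuous_on_sum continuous_on_subset[OF cont C(2)])
    show "continuous_on C g"
      using C0_continuous[OF g] C(2) by (rule continuous_on_subset)
    show "incseq (\<lambda>m. \<Sum>n<m. a n s)" for s
      using nonneg by (intro incseq_SucI) simp
    show "(\<lambda>m. \<Sum>n<m. a n s) \<longlonglongrightarrow> g s" if "s \<in> C" for s
      using sums C that by (auto simp: sums_def)
  qed (use C in auto)
  then have "\<forall>\<^sub>F m in sequentially. \<forall>x\<in>C. dist (\<Sum>n<m. a n x) (g x) < e"
    using e by (rule uniform_limitD)
  moreover have "dist (\<Sum>n<m. a n x) (g x) < e" if x: "x \<in> X - C" for x m
  proof -
    have "(\<Sum>n<m. a n x) \<le> g x" "0 \<le> (\<Sum>n<m. a n x)"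
      using sums[of x] x nonneg by (auto intro!: sum_le_sums_nonneg sum_nonneg)
    then show ?thesis
      using C(3)[OF x] by (simp add: dist_real_def)
  qed
  ultimately show "\<forall>\<^sub>F m in sequentially. \<forall>x\<in>X. dist (\<Sum>n<m. a n x) (g x) < e"
    by (auto elim!: eventually_mono)
qed

subsection \<open>Mercer expansions with coefficients in a sector\<close>

text \<open>What remains once the operator has been eliminated. \<open>rectangle_sums\<close> is the
  diagonal form tested against the indicators of two intervals; \<open>\<omega>\<close> and
  \<open>\<kappa>\<close> come from the sector and make the rotated real parts comparable to the
  moduli.\<close>

locale sectorial_expansion =
  fixes K :: kernel and \<psi> :: "nat \<Rightarrow> real \<Rightarrow> complex" and \<alpha> :: "nat \<Rightarrow> complex"
    and \<omega> :: complex and \<kappa> :: real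
  assumes K_C0: "(\<lambda>(s, t). K s t) \<in> C0 ({0..} \<times> {0..})"
    and psi_cont: "continuous_on {0..} (\<psi> n)"
    and omega: "cmod \<omega> = 1" and kappa: "0 < \<kappa>"
    and sector: "\<kappa> * cmod (\<alpha> n) \<le> Re (\<omega> * \<alpha> n)"
    and rectangle_sums: "\<lbrakk>0 \<le> a; a < b; 0 \<le> c; c < d\<rbrakk> \<Longrightarrow>
      (\<lambda>n. \<alpha> n * integral {a..b} (\<psi> n) * cnj (integral {c..d} (\<psi> n))) sums
        integral {a..b} (\<lambda>s. integral {c..d} (K s))"
begin

text \<open>The nonnegative weights that take the place of the eigenvalues in Mercer's
  argument.\<close>

definition r :: "nat \<Rightarrow> real" where "r n = Re (\<omega> * \<alpha> n)"

lemma r_nonneg: "0 \<le> r n"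
  unfolding r_def by (rule order_trans[OF _ sector]) (use kappa in simp)

lemma cmod_alpha_le: "cmod (\<alpha> n) \<le> r n / \<kappa>"
  using sector[of n] kappa by (simp add: r_def pos_le_divide_eq mult.commute)

lemma K_cont: "continuous_on ({0..} \<times> {0..}) (\<lambda>(s, t). K s t)"
  using K_C0 by (rule C0_continuous)

lemma K_cont1: "0 \<le> t \<Longrightarrow> continuous_on {0..} (\<lambda>s. K s t)"
  using continuous_on_compose2[OF K_cont, of "{0..}" "\<lambda>s. (s, t)"]
  by (simp add: continuous_on_Pair image_subset_iff)

lemma K_cont2: "0 \<le> s \<Longrightarrow> continuous_on {0..} (K s)"
  using continuous_on_compose2[OF K_cont, of "{0..}" "\<lambda>t. (s, t)"]
  by (simp add: continuous_on_Pair image_subset_iff)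

lemma psi_integrable: "0 \<le> a \<Longrightarrow> \<psi> n integrable_on {a..b}"
  by (intro integrable_continuous_interval continuous_on_subset[OF psi_cont]) auto

section \<open>Partial sums of the bilinear series and their integrals over rectangles\<close>

definition bilinear_term :: "nat \<Rightarrow> real \<Rightarrow> real \<Rightarrow> complex" where
  "bilinear_term n s t = \<alpha> n * \<psi> n s * cnj (\<psi> n t)"

definition partial_kernel :: "nat \<Rightarrow> real \<Rightarrow> real \<Rightarrow> complex" where
  "partial_kernel m s t = (\<Sum>n<m. bilinear_term n s t)"

lemma partial_kernel_cont: "continuous_on ({0..} \<times> {0..}) (\<lambda>z. partial_kernel m (fst z) (snd z))"
  unfolding partial_kernel_def bilinear_term_def
  by (intro continuous_intros continuous_on_compose2[OF psi_cont]) auto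

lemma partial_kernel_cont1: "0 \<le> t \<Longrightarrow> continuous_on {0..} (\<lambda>s. partial_kernel m s t)"
  unfolding partial_kernel_def bilinear_term_def by (intro continuous_intros psi_cont)

lemma partial_kernel_cont2: "0 \<le> s \<Longrightarrow> continuous_on {0..} (partial_kernel m s)"
  unfolding partial_kernel_def bilinear_term_def by (intro continuous_intros psi_cont)

lemma partial_kernel_integrable: "0 \<le> c \<Longrightarrow> partial_kernel m s integrable_on {c..d}"
  unfolding partial_kernel_def bilinear_term_def
  by (intro integrable_continuous_interval continuous_intros continuous_on_subset[OF psi_cont]) auto

lemma integral_partial_kernel:
  assumes "0 \<le> c"
  shows "integral {c..d} (partial_kernel m s) = (\<Sum>n<m. \<alpha> n * \<psi> n s * cnj (integral {c..d} (\<psi> n)))"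
  unfolding partial_kernel_def bilinear_term_def using psi_integrable[OF assms]
  by (subst integral_sum)
    (auto simp: integral_cnj integrable_on_cnj_iff intro!: integrable_on_mult_right)

lemma integral_partial_kernel_integrable:
  assumes "0 \<le> a" "0 \<le> c"
  shows "(\<lambda>s. integral {c..d} (partial_kernel m s)) integrable_on {a..b}"
  unfolding integral_partial_kernel[OF assms(2)]
  by (intro integrable_continuous_interval continuous_intros continuous_on_subset[OF psi_cont])
    (use assms in auto)

lemma integral_integral_partial_kernel:
  assumes "0 \<le> a" "0 \<le> c"
  shows "integral {a..b} (\<lambda>s. integral {c..d} (partial_kernel m s)) =
    (\<Sum>n<m. \<alpha> n * integral {a..b} (\<psi> n) * cnj (integral {c..d} (\<psi> n)))"
  unfolding integral_partial_kernel[OF assms(2)] using psi_integrable[OF assms(1)]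
  by (subst integral_sum) (auto intro!: integrable_on_mult_right integrable_on_mult_left)

lemma integral_K_integrable:
  assumes "0 \<le> a" "0 \<le> c"
  shows "(\<lambda>s. integral {c..d} (K s)) integrable_on {a..b}"
  unfolding cbox_interval[symmetric]
  by (intro integrable_continuous integral_continuous_on_param continuous_on_subset[OF K_cont])
    (use assms in auto)

text \<open>A negative value of the remainder kernel on the diagonal would make its integral
  over a small square negative, whereas that integral is a tail of a nonnegative series.\<close>

lemma diagonal_partial_sum_le:
  assumes s: "0 \<le> s"
  shows "(\<Sum>n<m. r n * (cmod (\<psi> n s))\<^sup>2) \<le> Re (\<omega> * K s s)"
proof (rule ccontr)
  assume neg: "\<not> ?thesis"
  define Q where "Q x t = Re (\<omega> * (K x t - partial_kernel m x t))" for x t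
  have Qss: "Q s s = Re (\<omega> * K s s) - (\<Sum>n<m. r n * (cmod (\<psi> n s))\<^sup>2)"
  proof -
    have "Re (\<omega> * (\<alpha> n * \<psi> n s * cnj (\<psi> n s))) = r n * (cmod (\<psi> n s))\<^sup>2" for n
      by (simp only: Re_mult_norm_square r_def)
    then show ?thesis
      by (simp only: Q_def partial_kernel_def bilinear_term_def right_diff_distrib
          sum_distrib_left minus_complex.simps Re_sum)
  qed
  have Q_cont: "continuous_on ({0..} \<times> {0..}) (\<lambda>z. Q (fst z) (snd z))"
    unfolding Q_def using K_cont partial_kernel_cont by (intro continuous_intros) (auto simp: case_prod_unfold)
  then have Q_cont': "continuous_on ({0..} \<times> {0..}) (\<lambda>(x, t). Q x t)"
    by (simp add: case_prod_unfold)
  \<comment> \<open>Half the size of the negative value: a perturbation below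
    \<open>\<delta>\<close> leaves \<open>Q\<close> at most \<open>- \<delta>\<close>.\<close>
  define \<delta> where "\<delta> = - Q s s / 2"
  have \<delta>: "0 < \<delta>" using neg Qss by (simp add: \<delta>_def)
  obtain e where e: "0 < e" "\<And>z. z \<in> {0..} \<times> {0..} \<Longrightarrow> dist z (s, s) < e \<Longrightarrow>
      dist (Q (fst z) (snd z)) (Q s s) < \<delta>"
    using Q_cont[unfolded continuous_on_iff, rule_format, of "(s, s)" \<delta>] s \<delta> by auto
  \<comment> \<open>Two coordinate distances of at most \<open>e / 4\<close> add up to less than
    \<open>e\<close>. The square extends from \<open>s\<close> upwards only, so it stays in the
    quadrant even for \<open>s = 0\<close>.\<close>
  define h where "h = e / 4"
  have h: "0 < h" using e by (simp add: h_def)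
  define I where "I = {s..s + h}"
  have Q_le: "Q x t \<le> - \<delta>" if "x \<in> I" "t \<in> I" for x t
  proof -
    have "dist (x, t) (s, s) \<le> dist x s + dist t s"
      by (simp add: dist_Pair_Pair sqrt_sum_squares_le_sum)
    also have "\<dots> < e" using that e(1) by (simp add: I_def h_def dist_real_def)
    finally have "dist (Q x t) (Q s s) < \<delta>"
      using e(2)[of "(x, t)"] that s by (simp add: I_def)
    then show ?thesis by (simp add: dist_real_def \<delta>_def)
  qed
  have sub: "I \<subseteq> {0..}" using s by (auto simp: I_def)
  have K_int: "K x integrable_on I" if "x \<in> I" for x
    using that sub K_cont2[of x] unfolding I_def
    by (intro integrable_continuous_interval) (auto intro: continuous_on_subset)
  have P_int: "partial_kernel m x integrable_on I" for x
    using partial_kernel_integrable[OF s] by (simp add: I_def)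
  have KI_int: "(\<lambda>x. integral I (K x)) integrable_on I"
    and PI_int: "(\<lambda>x. integral I (partial_kernel m x)) integrable_on I"
    unfolding I_def using integral_K_integrable[OF s s] integral_partial_kernel_integrable[OF s s] by auto
  define D where "D = integral I (\<lambda>x. integral I (K x)) - integral I (\<lambda>x. integral I (partial_kernel m x))"
  have D_eq: "Re (\<omega> * D) = integral I (\<lambda>x. integral I (Q x))"
  proof -
    have lin: "Re (\<omega> * integral I f) = integral I (\<lambda>x. Re (\<omega> * f x))" if "f integrable_on I" for f
      using integral_linear[OF that, of "\<lambda>z. Re (\<omega> * z)"]
      by (simp only: comp_def bounded_linear_compose[OF bounded_linear_Re bounded_linear_mult_right])
    have "D = integral I (\<lambda>x. integral I (K x) - integral I (partial_kernel m x))"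
      unfolding D_def using KI_int PI_int by (rule integral_diff[symmetric])
    then have "Re (\<omega> * D) = integral I (\<lambda>x. Re (\<omega> * (integral I (K x) - integral I (partial_kernel m x))))"
      using lin[OF integrable_diff[OF KI_int PI_int]] by (simp only:)
    also have "\<dots> = integral I (\<lambda>x. integral I (Q x))"
    proof (rule integral_cong)
      fix x assume x: "x \<in> I"
      have "integral I (K x) - integral I (partial_kernel m x) = integral I (\<lambda>t. K x t - partial_kernel m x t)"
        using K_int[OF x] P_int by (rule integral_diff[symmetric])
      then show "Re (\<omega> * (integral I (K x) - integral I (partial_kernel m x))) = integral I (Q x)"
        using lin[OF integrable_diff[OF K_int[OF x] P_int]] by (simp only: Q_def[abs_def])
    qed
    finally show ?thesis .
  qed
  have "integral I (\<lambda>x. integral I (Q x)) \<le> integral I (\<lambda>x. - \<delta> * h)"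
  proof (rule integral_le)
    show "(\<lambda>x. integral I (Q x)) integrable_on I"
      unfolding I_def cbox_interval[symmetric]
      by (intro integrable_continuous integral_continuous_on_param continuous_on_subset[OF Q_cont'])
        (use s in auto)
    fix x assume x: "x \<in> I"
    have "integral I (Q x) \<le> integral I (\<lambda>t. - \<delta>)"
    proof (rule integral_le)
      have "0 \<le> x" using x sub by auto
      then have "continuous_on {0..} (Q x)"
        using continuous_on_compose2[OF Q_cont, of "{0..}" "\<lambda>t. (x, t)"]
        by (simp add: continuous_on_Pair image_subset_iff)
      then have "continuous_on I (Q x)"
        using sub by (rule continuous_on_subset)
      then show "Q x integrable_on I"
        unfolding I_def by (rule integrable_continuous_interval)
    qed (use Q_le x in \<open>auto simp: I_def\<close>)
    then show "integral I (Q x) \<le> - \<delta> * h"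
      using h by (simp add: I_def mult.commute)
  qed (auto simp: I_def)
  also have "\<dots> = - (\<delta> * h * h)"
    using h by (simp add: I_def)
  also have "\<dots> < 0" using \<delta> h by simp
  finally have "Re (\<omega> * D) < 0" using D_eq by simp
  moreover have "0 \<le> Re (\<omega> * D)"
  proof -
    \<comment> \<open>Because both sides of the square are the same interval \<open>I\<close>, each
      term is \<open>\<alpha> n\<close> times a squared modulus, and its rotated real part is
      nonnegative.\<close>
    define T where "T n = \<alpha> n * integral I (\<psi> n) * cnj (integral I (\<psi> n))" for n
    have "T sums integral I (\<lambda>x. integral I (K x))"
      using rectangle_sums[of s "s + h" s "s + h"] s h by (simp add: T_def[abs_def] I_def)
    then have "(\<lambda>n. Re (\<omega> * T n)) sums Re (\<omega> * integral I (\<lambda>x. integral I (K x)))"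
      by (intro sums_Re sums_mult)
    moreover have "0 \<le> Re (\<omega> * T n)" for n
      using r_nonneg[of n] by (simp only: Re_mult_norm_square r_def T_def zero_le_mult_iff) simp
    ultimately have "(\<Sum>n<m. Re (\<omega> * T n)) \<le> Re (\<omega> * integral I (\<lambda>x. integral I (K x)))"
      by (intro sum_le_sums_nonneg) auto
    then show ?thesis
      by (simp only: D_def I_def integral_integral_partial_kernel[OF s s] T_def right_diff_distrib
          sum_distrib_left minus_complex.simps Re_sum)
  qed
  ultimately show False by simp
qed

section \<open>Uniform bounds and absolute convergence\<close>

lemma psi_square_sum_bounded:
  obtains B where "\<And>m s. 0 \<le> s \<Longrightarrow> (\<Sum>n<m. r n * (cmod (\<psi> n s))\<^sup>2) \<le> B"
proof -
  obtain B where B: "\<And>z. z \<in> {0..} \<times> {0..} \<Longrightarrow> cmod ((\<lambda>(s, t). K s t) z) \<le> B"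
    using C0_bounded[OF K_C0] by blast
  have "(\<Sum>n<m. r n * (cmod (\<psi> n s))\<^sup>2) \<le> B" if "0 \<le> s" for m s
  proof -
    have "Re (\<omega> * K s s) \<le> cmod (\<omega> * K s s)" by (rule complex_Re_le_cmod)
    also have "\<dots> = cmod (K s s)" using omega by (simp add: norm_mult)
    also have "\<dots> \<le> B" using B[of "(s, s)"] that by simp
    finally show ?thesis using diagonal_partial_sum_le[OF that, of m] by linarith
  qed
  then show ?thesis by (rule that)
qed

text \<open>The square root splits the weight evenly between the two variables, so that the squares
  of the factors form the series on the diagonal.\<close>

definition p :: "nat \<Rightarrow> real \<Rightarrow> real" where "p n s = sqrt (r n) * cmod (\<psi> n s)"

lemma p_nonneg: "0 \<le> p n s"
  using r_nonneg[of n] by (simp add: p_def)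

lemma p_square: "(p n s)\<^sup>2 = r n * (cmod (\<psi> n s))\<^sup>2"
  using r_nonneg[of n] by (simp add: p_def power_mult_distrib)

lemma cmod_bilinear_term_le: "cmod (bilinear_term n s t) \<le> p n s * (p n t / \<kappa>)"
proof -
  have "cmod (bilinear_term n s t) = cmod (\<alpha> n) * (cmod (\<psi> n s) * cmod (\<psi> n t))"
    by (simp add: bilinear_term_def norm_mult)
  also have "\<dots> \<le> (r n / \<kappa>) * (cmod (\<psi> n s) * cmod (\<psi> n t))"
    by (intro mult_right_mono cmod_alpha_le) auto
  also have "\<dots> = p n s * (p n t / \<kappa>)"
    using r_nonneg[of n] by (simp add: p_def)
  finally show ?thesis .
qed

text \<open>The inequality between geometric and arithmetic means reduces each term to squares at
  \<open>s\<close> and at \<open>t\<close>, whose sums are bounded by the diagonal estimate. The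
  bound does not depend on the point and later serves as majorant for dominated convergence.\<close>

lemma sum_cmod_bilinear_term_bounded:
  obtains B where "\<And>m s t. 0 \<le> s \<Longrightarrow> 0 \<le> t \<Longrightarrow> (\<Sum>n<m. cmod (bilinear_term n s t)) \<le> B"
proof -
  obtain B where B: "\<And>m s. 0 \<le> s \<Longrightarrow> (\<Sum>n<m. r n * (cmod (\<psi> n s))\<^sup>2) \<le> B"
    using psi_square_sum_bounded by blast
  have "(\<Sum>n<m. cmod (bilinear_term n s t)) \<le> B / \<kappa>" if "0 \<le> s" "0 \<le> t" for m s t
  proof -
    have "cmod (bilinear_term n s t) \<le> ((p n s)\<^sup>2 + (p n t)\<^sup>2) / (2 * \<kappa>)" for n
    proof -
      have "p n s * p n t \<le> ((p n s)\<^sup>2 + (p n t)\<^sup>2) / 2"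
        using sum_squares_bound[of "p n s" "p n t"] by simp
      then show ?thesis
        using cmod_bilinear_term_le[of n s t] kappa by (simp add: field_simps)
    qed
    then have "(\<Sum>n<m. cmod (bilinear_term n s t)) \<le> (\<Sum>n<m. ((p n s)\<^sup>2 + (p n t)\<^sup>2) / (2 * \<kappa>))"
      by (intro sum_mono)
    also have "\<dots> = ((\<Sum>n<m. (p n s)\<^sup>2) + (\<Sum>n<m. (p n t)\<^sup>2)) / (2 * \<kappa>)"
      by (simp add: sum.distrib flip: sum_divide_distrib)
    also have "\<dots> \<le> (B + B) / (2 * \<kappa>)"
      using kappa B that by (intro divide_right_mono add_mono) (auto simp: p_square)
    finally show ?thesis by simp
  qed
  then show ?thesis by (rule that)
qed

lemma summable_cmod_bilinear_term:
  assumes "0 \<le> s" "0 \<le> t"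
  shows "summable (\<lambda>n. cmod (bilinear_term n s t))"
proof -
  obtain B where "\<And>m s t. 0 \<le> s \<Longrightarrow> 0 \<le> t \<Longrightarrow> (\<Sum>n<m. cmod (bilinear_term n s t)) \<le> B"
    using sum_cmod_bilinear_term_bounded by blast
  then show ?thesis
    using assms by (intro summableI_nonneg_bounded[where x = B]) auto
qed

text \<open>The set \<open>X\<close> is left general for two uses: a single point gives uniformity
  in one variable with the other fixed, and the whole half-line gives joint uniformity. The two
  conclusions let the variable from \<open>X\<close> be the first or the second argument of the
  kernel; the factor \<open>1 / \<kappa>\<close> goes to the bounded side.\<close>

lemma uniformly_convergent_partial_kernel:
  assumes "X \<subseteq> {0..}" and unif: "uniformly_convergent_on X (\<lambda>m s. \<Sum>n<m. (p n s)\<^sup>2)"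
  shows "uniformly_convergent_on (X \<times> {0..}) (\<lambda>m (s, t). partial_kernel m s t)"
    and "uniformly_convergent_on (X \<times> {0..}) (\<lambda>m (t, s). partial_kernel m s t)"
proof -
  obtain B where B: "\<And>m s. 0 \<le> s \<Longrightarrow> (\<Sum>n<m. r n * (cmod (\<psi> n s))\<^sup>2) \<le> B"
    using psi_square_sum_bounded by blast
  have B': "(\<Sum>n<m. (p n t / \<kappa>)\<^sup>2) \<le> B / \<kappa>\<^sup>2" if "t \<in> {0..}" for m t
    using B[of t m] that kappa
    by (simp add: power_divide p_square divide_right_mono flip: sum_divide_distrib)
  have nn: "0 \<le> p n t / \<kappa>" for n t
    using p_nonneg kappa by simp
  show "uniformly_convergent_on (X \<times> {0..}) (\<lambda>m (s, t). partial_kernel m s t)"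
    unfolding partial_kernel_def
    by (rule uniformly_convergent_bilinear_series[OF cmod_bilinear_term_le p_nonneg nn unif B'])
  have "cmod (bilinear_term n t s) \<le> p n s * (p n t / \<kappa>)" for n s t
    using cmod_bilinear_term_le[of n t s] by (simp add: mult.commute)
  then show "uniformly_convergent_on (X \<times> {0..}) (\<lambda>m (t, s). partial_kernel m s t)"
    unfolding partial_kernel_def
    by (rule uniformly_convergent_bilinear_series[OF _ p_nonneg nn unif B'])
qed

section \<open>The sum of the series and its identity with the kernel\<close>

definition L :: "real \<Rightarrow> real \<Rightarrow> complex" where
  "L s t = lim (\<lambda>m. partial_kernel m s t)"

lemma uniformly_convergent_p_singleton:
  assumes "0 \<le> s"
  shows "uniformly_convergent_on {s} (\<lambda>m s. \<Sum>n<m. (p n s)\<^sup>2)"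
proof -
  obtain B where "\<And>m s. 0 \<le> s \<Longrightarrow> (\<Sum>n<m. r n * (cmod (\<psi> n s))\<^sup>2) \<le> B"
    using psi_square_sum_bounded by blast
  then have "summable (\<lambda>n. (p n s)\<^sup>2)"
    using assms by (intro summableI_nonneg_bounded[where x = B]) (auto simp: p_square[symmetric])
  then show ?thesis
    by (simp add: uniformly_convergent_on_singleton summable_iff_convergent)
qed

text \<open>With one variable fixed, the uniformity required in it is mere summability at a point.
  This is what makes the sum \<open>L\<close> separately continuous.\<close>

lemma uniform_limit_partial_kernel:
  assumes "0 \<le> s"
  shows uniform_limit_partial_kernel1: "uniform_limit {0..} (\<lambda>m t. partial_kernel m t s) (\<lambda>t. L t s) sequentially"
    and uniform_limit_partial_kernel2: "uniform_limit {0..} (\<lambda>m. partial_kernel m s) (L s) sequentially"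
  using uniformly_convergent_partial_kernel[OF _ uniformly_convergent_p_singleton[OF assms]] assms
  by (simp_all add: uniformly_convergent_uniform_limit_iff uniform_limit_iff L_def case_prod_unfold)

lemma tendsto_partial_kernel: "0 \<le> s \<Longrightarrow> 0 \<le> t \<Longrightarrow> (\<lambda>m. partial_kernel m s t) \<longlonglongrightarrow> L s t"
  by (rule tendsto_uniform_limitI[OF uniform_limit_partial_kernel2]) auto

lemma L_cont1: "0 \<le> t \<Longrightarrow> continuous_on {0..} (\<lambda>s. L s t)"
  by (rule uniform_limit_theorem[OF _ uniform_limit_partial_kernel1]) (auto intro!: always_eventually partial_kernel_cont1)

lemma L_cont2: "0 \<le> s \<Longrightarrow> continuous_on {0..} (L s)"
  by (rule uniform_limit_theorem[OF _ uniform_limit_partial_kernel2]) (auto intro!: always_eventually partial_kernel_cont2)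

lemma partial_kernel_L_bounded:
  obtains B where "\<And>m s t. 0 \<le> s \<Longrightarrow> 0 \<le> t \<Longrightarrow> cmod (partial_kernel m s t) \<le> B"
    "\<And>s t. 0 \<le> s \<Longrightarrow> 0 \<le> t \<Longrightarrow> cmod (L s t) \<le> B"
proof -
  obtain B where B: "\<And>m s t. 0 \<le> s \<Longrightarrow> 0 \<le> t \<Longrightarrow> (\<Sum>n<m. cmod (bilinear_term n s t)) \<le> B"
    using sum_cmod_bilinear_term_bounded by blast
  have *: "cmod (partial_kernel m s t) \<le> B" if "0 \<le> s" "0 \<le> t" for m s t
    unfolding partial_kernel_def using norm_sum B[OF that] by (rule order_trans)
  moreover have "cmod (L s t) \<le> B" if "0 \<le> s" "0 \<le> t" for s t
    using tendsto_norm[OF tendsto_partial_kernel[OF that]] *[OF that]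
    by (intro LIMSEQ_le_const2) auto
  ultimately show ?thesis by (rule that)
qed

text \<open>Dominated convergence twice, with majorant \<open>B\<close> for the inner integral and
  \<open>B * (d - c)\<close> for the outer one. The limit is then compared with the one in
  \<open>rectangle_sums\<close>.\<close>

lemma rectangle_integral_L:
  assumes ab: "0 \<le> a" "a < b" and cd: "0 \<le> c" "c < d"
  shows "(\<lambda>s. integral {c..d} (L s)) integrable_on {a..b}"
    "integral {a..b} (\<lambda>s. integral {c..d} (L s)) = integral {a..b} (\<lambda>s. integral {c..d} (K s))"
proof -
  obtain B where B: "\<And>m s t. 0 \<le> s \<Longrightarrow> 0 \<le> t \<Longrightarrow> cmod (partial_kernel m s t) \<le> B"
    using partial_kernel_L_bounded by metis
  have inner: "(\<lambda>m. integral {c..d} (partial_kernel m s)) \<longlonglongrightarrow> integral {c..d} (L s)" if "0 \<le> s" for s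
    by (rule dominated_convergence[where h = "\<lambda>_. B"])
      (use that cd B in \<open>auto intro!: partial_kernel_integrable tendsto_partial_kernel\<close>)
  have bound: "norm (integral {c..d} (partial_kernel m s)) \<le> B * (d - c)" if "0 \<le> s" for m s
    using that cd B
    by (intro integral_bound continuous_on_subset[OF partial_kernel_cont2]) auto
  have outer: "(\<lambda>s. integral {c..d} (L s)) integrable_on {a..b}"
    "(\<lambda>m. integral {a..b} (\<lambda>s. integral {c..d} (partial_kernel m s)))
      \<longlonglongrightarrow> integral {a..b} (\<lambda>s. integral {c..d} (L s))"
    by (rule dominated_convergence[where h = "\<lambda>_. B * (d - c)" and
          f = "\<lambda>m s. integral {c..d} (partial_kernel m s)"];
        use ab cd bound inner in \<open>auto intro!: integral_partial_kernel_integrable\<close>)+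
  show "(\<lambda>s. integral {c..d} (L s)) integrable_on {a..b}" by (rule outer)
  show "integral {a..b} (\<lambda>s. integral {c..d} (L s)) = integral {a..b} (\<lambda>s. integral {c..d} (K s))"
    using outer(2) rectangle_sums[OF ab cd] unfolding integral_integral_partial_kernel[OF ab(1) cd(1)] sums_def
    by (rule LIMSEQ_unique)
qed

text \<open>The difference \<open>E\<close> is separately continuous with vanishing integrals over
  rectangles. The vanishing principle is applied first in \<open>s\<close>, to the integral of
  \<open>E\<close> over \<open>{c..d}\<close>, and then in \<open>t\<close>.\<close>

lemma L_eq_K:
  assumes s: "0 \<le> s" and t: "0 \<le> t"
  shows "L s t = K s t"
proof -
  define E where "E s t = K s t - L s t" for s t
  have E_cont1: "continuous_on {0..} (\<lambda>s. E s t)" if "0 \<le> t" for t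
    unfolding E_def using that by (intro continuous_intros K_cont1 L_cont1)
  have E_cont2: "continuous_on {0..} (E s)" if "0 \<le> s" for s
    unfolding E_def using that by (intro continuous_intros K_cont2 L_cont2)
  obtain A where A: "\<And>z. z \<in> {0..} \<times> {0..} \<Longrightarrow> cmod ((\<lambda>(s, t). K s t) z) \<le> A"
    using C0_bounded[OF K_C0] by blast
  obtain B where B: "\<And>s t. 0 \<le> s \<Longrightarrow> 0 \<le> t \<Longrightarrow> cmod (L s t) \<le> B"
    using partial_kernel_L_bounded by metis
  have E_bdd: "cmod (E s t) \<le> A + B" if "0 \<le> s" "0 \<le> t" for s t
    using A[of "(s, t)"] B[OF that] that norm_triangle_ineq4[of "K s t" "L s t"]
    by (simp add: E_def)
  have "integral {c..d} (E s) = 0" if cd: "0 \<le> c" "c < d" for c d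
  proof (rule continuous_zero_if_integrals_zero[OF _ _ s])
    show "continuous_on {0..} (\<lambda>s. integral {c..d} (E s))"
      by (rule continuous_on_integral_separately_continuous[where B = "A + B"])
        (use cd E_bdd in \<open>auto intro: continuous_on_subset[OF E_cont1] continuous_on_subset[OF E_cont2]\<close>)
    fix a b :: real assume ab: "0 \<le> a" "a < b"
    have "integral {a..b} (\<lambda>s. integral {c..d} (E s)) =
        integral {a..b} (\<lambda>s. integral {c..d} (K s) - integral {c..d} (L s))"
      unfolding E_def using ab cd
      by (intro integral_cong integral_diff integrable_continuous_interval
          continuous_on_subset[OF K_cont2] continuous_on_subset[OF L_cont2]) auto
    also have "\<dots> = 0"
      using rectangle_integral_L[OF ab cd] integral_K_integrable[OF ab(1) cd(1)]
      by (subst integral_diff) auto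
    finally show "integral {a..b} (\<lambda>s. integral {c..d} (E s)) = 0" .
  qed
  then have "E s t = 0"
    by (rule continuous_zero_if_integrals_zero[OF E_cont2[OF s] _ t])
  then show ?thesis by (simp add: E_def)
qed

section \<open>Uniform convergence on the whole quadrant\<close>

lemma diagonal_C0: "(\<lambda>s. Re (\<omega> * K s s)) \<in> C0 {0..}"
  unfolding C0_def mem_Collect_eq
proof (intro conjI allI impI)
  have "continuous_on {0..} (\<lambda>s. K s s)"
    using continuous_on_compose2[OF K_cont, of "{0..}" "\<lambda>s. (s, s)"]
    by (simp add: continuous_on_Pair image_subset_iff)
  then show "continuous_on {0..} (\<lambda>s. Re (\<omega> * K s s))"
    by (intro continuous_intros)
  fix e :: real assume "0 < e"
  then obtain C where C: "compact C" "C \<subseteq> {0..} \<times> {0..}"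
    "\<And>z. z \<in> {0..} \<times> {0..} - C \<Longrightarrow> cmod ((\<lambda>(s, t). K s t) z) < e"
    using C0_D[OF K_C0] by blast
  \<comment> \<open>A point \<open>s\<close> outside the projection of \<open>C\<close> has
    \<open>(s, s)\<close> outside \<open>C\<close>, so the projection serves as the compact set on
    the half-line.\<close>
  have "compact (fst ` C)"
    by (intro compact_continuous_image continuous_intros C)
  moreover have "fst ` C \<subseteq> {0..}"
    using C(2) by auto
  moreover have "norm (Re (\<omega> * K s s)) < e" if "s \<in> {0..} - fst ` C" for s
  proof -
    have "(s, s) \<notin> C" using that by force
    then have "cmod (K s s) < e" using C(3)[of "(s, s)"] that by auto
    then show ?thesis
      using abs_Re_le_cmod[of "\<omega> * K s s"] omega by (simp add: norm_mult)
  qed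
  ultimately show "\<exists>C. compact C \<and> C \<subseteq> {0..} \<and> (\<forall>s\<in>{0..} - C. norm (Re (\<omega> * K s s)) < e)"
    by blast
qed

lemma uniform_limit_partial_kernel_K:
  "uniform_limit ({0..} \<times> {0..}) (\<lambda>m (s, t). partial_kernel m s t) (\<lambda>(s, t). K s t) sequentially"
proof -
  have "uniform_limit {0..} (\<lambda>m s. \<Sum>n<m. (p n s)\<^sup>2) (\<lambda>s. Re (\<omega> * K s s)) sequentially"
  proof (rule uniform_limit_nonneg_series_C0[OF _ _ diagonal_C0])
    show "continuous_on {0..} (\<lambda>s. (p n s)\<^sup>2)" for n
      unfolding p_def by (intro continuous_intros psi_cont)
    \<comment> \<open>The identity of \<open>L\<close> and \<open>K\<close> sharpens the earlier
      inequality on the diagonal to an equality, so the limit in Dini's theorem is known to be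
      continuous.\<close>
    show "(\<lambda>n. (p n s)\<^sup>2) sums Re (\<omega> * K s s)" if "s \<in> {0..}" for s
    proof -
      have "(\<lambda>n. bilinear_term n s s) sums K s s"
        using tendsto_partial_kernel[of s s] L_eq_K[of s s] that by (simp add: sums_def partial_kernel_def)
      then have "(\<lambda>n. Re (\<omega> * bilinear_term n s s)) sums Re (\<omega> * K s s)"
        by (intro sums_Re sums_mult)
      then show ?thesis
        unfolding bilinear_term_def Re_mult_norm_square p_square r_def .
    qed
  qed auto
  then have "uniformly_convergent_on {0..} (\<lambda>m s. \<Sum>n<m. (p n s)\<^sup>2)"
    by (auto simp: uniformly_convergent_on_def)
  then have "uniform_limit ({0..} \<times> {0..}) (\<lambda>m (s, t). partial_kernel m s t)
      (\<lambda>z. lim (\<lambda>m. case z of (s, t) \<Rightarrow> partial_kernel m s t)) sequentially"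
    using uniformly_convergent_partial_kernel(1)[of "{0..}"]
    by (simp add: uniformly_convergent_uniform_limit_iff)
  then show ?thesis
    by (rule uniform_limit_cong'[THEN iffD1, rotated 2]) (auto simp: L_eq_K[symmetric] L_def)
qed

end

subsection \<open>The Hilbert space and integral operators with continuous kernels\<close>

abbreviation half_line :: "real measure" where "half_line \<equiv> lebesgue_on {0..}"

abbreviation ind :: "real \<Rightarrow> real \<Rightarrow> real \<Rightarrow> complex" where
  "ind a b \<equiv> \<lambda>x. indicator {a..b} x"

lemma sigma_finite_half_line: "sigma_finite_measure half_line"
proof
  show "\<exists>A. countable A \<and> A \<subseteq> sets half_line \<and> \<Union>A = space half_line \<and>
      (\<forall>a\<in>A. emeasure half_line a \<noteq> \<infinity>)"
  proof (intro exI conjI)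
    show "countable (range (\<lambda>n::nat. {0..real n}))" by simp
    show "range (\<lambda>n::nat. {0..real n}) \<subseteq> sets half_line"
      by (auto simp: sets_restrict_space intro!: image_eqI[of _ _ "{0..real _}"])
    show "\<Union>(range (\<lambda>n::nat. {0..real n})) = space half_line"
      using real_arch_simple by (auto simp: space_restrict_space)
    show "\<forall>a\<in>range (\<lambda>n::nat. {0..real n}). emeasure half_line a \<noteq> \<infinity>"
      by (auto simp: emeasure_restrict_space)
  qed
qed

interpretation half_line: sigma_finite_measure half_line
  by (rule sigma_finite_half_line)

interpretation half_line_pair: pair_sigma_finite half_line half_line ..

section \<open>Complex Hilbert space calculus on equivalence classes\<close>

lemma L2_rel_refl: "sq_integrable f \<Longrightarrow> L2_rel f f"
  by (simp add: L2_rel_def)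

lemma sq_integrable_rep_L2: "sq_integrable (rep_L2 f)"
  using Quotient_rep_reflp[OF Quotient_L2, of f] by (simp add: L2_rel_def)

lemma abs_rep_L2: "abs_L2 (rep_L2 f) = f"
  by (rule Quotient_abs_rep[OF Quotient_L2])

lemma abs_L2_eqI:
  assumes "sq_integrable f" "sq_integrable g" "AE x in half_line. f x = g x"
  shows "abs_L2 f = abs_L2 g"
  using assms by (intro Quotient_rel_abs[OF Quotient_L2]) (simp add: L2_rel_def)

lemma cinner_abs_L2:
  assumes "sq_integrable f" "sq_integrable g"
  shows "cinner (abs_L2 f) (abs_L2 g) = (LINT x|half_line. f x * cnj (g x))"
  using assms by (intro cinner.abs_eq L2_rel_refl)

lemma cinner_abs_L2_right:
  assumes "sq_integrable g"
  shows "cinner f (abs_L2 g) = (LINT x|half_line. rep_L2 f x * cnj (g x))"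
  using cinner_abs_L2[OF sq_integrable_rep_L2 assms] by (simp add: abs_rep_L2)

lemma scaleC_abs_L2: "sq_integrable f \<Longrightarrow> c *\<^sub>C abs_L2 f = abs_L2 (\<lambda>x. c * f x)"
  by (intro scaleC.abs_eq L2_rel_refl)

lemma scaleC_scaleC: "a *\<^sub>C b *\<^sub>C f = (a * b) *\<^sub>C f"
  by transfer (auto simp: L2_rel_def mult.assoc intro!: sq_integrable_mult_left)

lemma scaleC_one: "1 *\<^sub>C f = f"
  by transfer (simp add: L2_rel_def)

lemma cinner_add_right: "cinner f (g + h) = cinner f g + cinner f h"
  by (subst (1 2 3) cinner_commute) (simp add: cinner_add_left)

lemma cinner_scaleC_right: "cinner f (c *\<^sub>C g) = cnj c * cinner f g"
  by (subst (1 2) cinner_commute) (simp add: cinner_scaleC_left)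

lemma cinner_self_norm: "cinner f f = of_real ((norm f)\<^sup>2)"
  using cinner_self[of f] by (simp add: norm_L2_def inner_L2_def)

lemma norm_abs_L2:
  assumes "sq_integrable f"
  shows "(norm (abs_L2 f))\<^sup>2 = (LINT x|half_line. (cmod (f x))\<^sup>2)"
proof -
  have "complex_of_real ((norm (abs_L2 f))\<^sup>2) = of_real (LINT x|half_line. (cmod (f x))\<^sup>2)"
    unfolding cinner_self_norm[symmetric] cinner_abs_L2[OF assms assms]
    by (simp add: complex_norm_square[symmetric] flip: of_real_power)
  then show ?thesis by (simp only: of_real_eq_iff)
qed

lemma norm_scaleC: "norm (c *\<^sub>C f) = cmod c * norm f"
proof -
  have "complex_of_real ((norm (c *\<^sub>C f))\<^sup>2) = of_real ((cmod c * norm f)\<^sup>2)"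
    unfolding cinner_self_norm[symmetric] cinner_scaleC_left cinner_scaleC_right
    unfolding cinner_self_norm power_mult_distrib of_real_mult complex_norm_square[of c]
    by (simp add: mult_ac)
  then show ?thesis
    by (simp only: of_real_eq_iff) (simp add: power2_eq_iff_nonneg)
qed

text \<open>Multiplying \<open>f\<close> by a number of modulus 1 makes the inner product real and
  nonnegative, which reduces the claim to the real inequality.\<close>

lemma cinner_Cauchy_Schwarz: "cmod (cinner f g) \<le> norm f * norm g"
proof (cases "cinner f g = 0")
  case False
  define w where "w = cnj (sgn (cinner f g))"
  have w: "cmod w = 1" using False by (simp add: w_def norm_sgn)
  have "w * cinner f g = of_real (cmod (cinner f g))"
    using False unfolding w_def sgn_div_norm
    by (simp add: field_simps scaleR_conv_of_real complex_norm_square[symmetric] power2_eq_square)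
  then have "cmod (cinner f g) = inner (w *\<^sub>C f) g"
    by (simp add: inner_L2_def cinner_scaleC_left)
  also have "\<dots> \<le> norm (w *\<^sub>C f) * norm g"
    by (rule norm_cauchy_schwarz)
  finally show ?thesis by (simp add: norm_scaleC w)
qed simp

lemma bounded_linear_cinner_left: "bounded_linear (\<lambda>f. cinner f g)"
  by (rule bounded_linear_intro[where K = "norm g"])
    (simp_all add: cinner_add_left scaleR_L2_def cinner_scaleC_left scaleR_conv_of_real
      cinner_Cauchy_Schwarz)

text \<open>The map is conjugate-linear over the complex numbers but linear over the reals, the
  scalars to which \<open>bounded_linear\<close> refers.\<close>

lemma bounded_linear_cinner_right: "bounded_linear (\<lambda>f. cinner g f)"
  by (rule bounded_linear_intro[where K = "norm g"])
    (simp_all add: cinner_add_right scaleR_L2_def cinner_scaleC_right scaleR_conv_of_real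
      cinner_Cauchy_Schwarz mult.commute[of _ "norm g"])

text \<open>Uniqueness of \<open>h\<close> comes from density: a difference of two candidates is
  orthogonal to the domain, hence to its closure, hence to itself.\<close>

lemma adjoint_opI:
  assumes T: "densely_defined T"
    and h: "\<And>f u. T f = Some u \<Longrightarrow> cinner u g = cinner f h"
  shows "adjoint_op T g = Some h"
proof -
  have unique: "h' = h" if h': "\<forall>f u. T f = Some u \<longrightarrow> cinner u g = cinner f h'" for h'
  proof -
    have "closed {f. f \<bullet> (h' - h) = 0}"
      by (intro closed_Collect_eq continuous_intros)
    moreover have "dom T \<subseteq> {f. f \<bullet> (h' - h) = 0}"
    proof
      fix f assume "f \<in> dom T"
      then obtain u where "T f = Some u" by auto
      then have "cinner f h' = cinner f h" using h h' by metis
      then have "f \<bullet> h' = f \<bullet> h" by (simp add: inner_L2_def)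
      then show "f \<in> {f. f \<bullet> (h' - h) = 0}"
        by (simp add: inner_diff_right)
    qed
    ultimately have "closure (dom T) \<subseteq> {f. f \<bullet> (h' - h) = 0}"
      by (intro closure_minimal)
    then have "h' - h \<in> {f. f \<bullet> (h' - h) = 0}"
      using T unfolding densely_defined_def by blast
    then show ?thesis by simp
  qed
  have "\<exists>!h. \<forall>f u. T f = Some u \<longrightarrow> cinner u g = cinner f h"
    using h unique by blast
  moreover have "(THE h. \<forall>f u. T f = Some u \<longrightarrow> cinner u g = cinner f h) = h"
    using h unique by (intro the_equality) blast+
  ultimately show ?thesis
    by (simp add: adjoint_op_def)
qed

section \<open>Pairings with indicators of bounded intervals\<close>

lemma integrable_indicator_continuous:
  fixes f :: "real \<Rightarrow> 'a::euclidean_space"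
  assumes "continuous_on {0..} f" "0 \<le> a"
  shows "integrable half_line (\<lambda>x. indicator {a..b} x *\<^sub>R f x)"
proof -
  have "integrable lborel (\<lambda>x. indicator {a..b} x *\<^sub>R f x)"
    by (intro borel_integrable_compact continuous_on_subset[OF assms(1)]) (use assms in auto)
  then have "integrable lebesgue (\<lambda>x. indicator {a..b} x *\<^sub>R f x)"
    by (subst integrable_completion) auto
  moreover have "(\<lambda>x. indicator {a..b} x *\<^sub>R f x) =
      (\<lambda>x. indicator {0..} x *\<^sub>R (indicator {a..b} x *\<^sub>R f x))"
    using assms(2) by (auto simp: indicator_def)
  ultimately have "integrable lebesgue (\<lambda>x. indicator {0..} x *\<^sub>R (indicator {a..b} x *\<^sub>R f x))"
    by metis
  then show ?thesis
    by (simp add: integrable_restrict_space)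
qed

lemma sq_integrable_ind: "0 \<le> a \<Longrightarrow> sq_integrable (ind a b)"
proof -
  assume a: "0 \<le> a"
  have "integrable half_line (\<lambda>x. indicator {a..b} x *\<^sub>R (1::real))"
    by (intro integrable_indicator_continuous continuous_intros a)
  moreover have "(\<lambda>x. indicator {a..b} x *\<^sub>R (1::real)) = (\<lambda>x. (cmod (ind a b x))\<^sup>2)"
    by (auto simp: indicator_def)
  moreover have "integrable half_line (\<lambda>x. indicator {a..b} x *\<^sub>R (1::complex))"
    by (intro integrable_indicator_continuous continuous_intros a)
  moreover have "(\<lambda>x. indicator {a..b} x *\<^sub>R (1::complex)) = ind a b"
    by (auto simp: indicator_def)
  ultimately show ?thesis
    by (auto simp: sq_integrable_def dest: borel_measurable_integrable)
qed

lemma LINT_ind: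
  assumes "integrable half_line (\<lambda>x. ind a b x * f x)" "0 \<le> a"
  shows "(LINT x|half_line. ind a b x * f x) = integral {a..b} f"
proof -
  have "(LINT x|half_line. ind a b x * f x) = integral {0..} (\<lambda>x. ind a b x * f x)"
    using assms by (intro lebesgue_integral_eq_integral) auto
  also have "\<dots> = integral {0..} (\<lambda>x. if x \<in> {a..b} then f x else 0)"
    by (intro integral_cong) (auto simp: indicator_def)
  also have "\<dots> = integral ({a..b} \<inter> {0..}) f"
    by (rule integral_restrict_Int)
  also have "{a..b} \<inter> {0..} = {a..b}"
    using assms(2) by auto
  finally show ?thesis .
qed

text \<open>The bridge from inner products of classes to the interval integrals in which the Mercer
  argument is phrased.\<close>

lemma cinner_ind:
  assumes "sq_integrable f" "0 \<le> a"
  shows "cinner (abs_L2 f) (abs_L2 (ind a b)) = integral {a..b} f"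
proof -
  have cnj_ind: "cnj (ind a b x) = ind a b x" for x
    by (simp add: indicator_def)
  have "integrable half_line (\<lambda>x. f x * cnj (ind a b x))"
    by (intro integrable_mult_cnj assms sq_integrable_ind)
  then show ?thesis
    using assms by (simp add: cinner_abs_L2 sq_integrable_ind cnj_ind mult.commute[of "f _"] LINT_ind)
qed

lemma integral_eq_if_abs_L2_eq:
  assumes "sq_integrable f" "sq_integrable g" "abs_L2 f = abs_L2 g" "0 \<le> a"
  shows "integral {a..b} f = integral {a..b} g"
  using cinner_ind[OF assms(1,4)] cinner_ind[OF assms(2,4)] assms(3) by simp

section \<open>Carleman functions and measurability of the kernel\<close>

lemma K0_kernelD:
  assumes "K0_kernel K T"
  shows "(\<lambda>(s, t). K s t) \<in> C0 ({0..} \<times> {0..})" "continuous_on ({0..} \<times> {0..}) (\<lambda>(s, t). K s t)"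
    and "\<And>s. 0 \<le> s \<Longrightarrow> sq_integrable (K s)" "\<And>t. 0 \<le> t \<Longrightarrow> sq_integrable (\<lambda>s. K s t)"
    and "continuous_on {0..} (carleman_fun K)" "densely_defined T"
    and "\<And>f u. T f = Some u \<Longrightarrow> AE s in half_line.
      rep_L2 u s = (LINT t|half_line. K s t * rep_L2 f t)"
proof -
  show "(\<lambda>(s, t). K s t) \<in> C0 ({0..} \<times> {0..})" "continuous_on ({0..} \<times> {0..}) (\<lambda>(s, t). K s t)"
    "continuous_on {0..} (carleman_fun K)" "densely_defined T"
    "\<And>s. 0 \<le> s \<Longrightarrow> sq_integrable (K s)" "\<And>t. 0 \<le> t \<Longrightarrow> sq_integrable (\<lambda>s. K s t)"
    using assms by (simp_all add: K0_kernel_def C0_def induces_def)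
  fix f u assume "T f = Some u"
  then have "AE s in half_line. integrable half_line (\<lambda>t. K s t * rep_L2 f t) \<and>
      rep_L2 u s = (LINT t|half_line. K s t * rep_L2 f t)"
    using assms by (auto simp: K0_kernel_def induces_def)
  then show "AE s in half_line. rep_L2 u s = (LINT t|half_line. K s t * rep_L2 f t)"
    by eventually_elim simp
qed

lemma sq_integrable_cnj: "sq_integrable f \<Longrightarrow> sq_integrable (\<lambda>x. cnj (f x))"
  unfolding sq_integrable_def
  by (auto intro: borel_measurable_continuous_on[where f = cnj] continuous_intros)

lemma cinner_carleman_fun:
  assumes "K0_kernel K T" "0 \<le> s"
  shows "cinner f (carleman_fun K s) = (LINT t|half_line. K s t * rep_L2 f t)"
  using K0_kernelD(3)[OF assms]
  by (simp add: carleman_fun_def cinner_abs_L2_right sq_integrable_cnj mult.commute)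

lemma norm_carleman_fun:
  assumes "K0_kernel K T" "0 \<le> s"
  shows "(norm (carleman_fun K s))\<^sup>2 = (LINT t|half_line. (cmod (K s t))\<^sup>2)"
  using K0_kernelD(3)[OF assms]
  by (simp add: carleman_fun_def norm_abs_L2 sq_integrable_cnj)

text \<open>Fubini's theorem asks for measurability with respect to the product of the two half-line
  measures, while \<open>measurable_kernel\<close> refers to planar Lebesgue measure. Continuity
  supplies it: the extension of the kernel by zero is Borel.\<close>

lemma kernel_borel_measurable:
  assumes "continuous_on ({0..} \<times> {0..}) (\<lambda>(s, t). K s t)"
  shows "(\<lambda>(x, t). ind a b x * K x t) \<in> borel_measurable (half_line \<Otimes>\<^sub>M half_line)"
proof -
  have k: "(\<lambda>z. indicator ({0..} \<times> {0..}) z *\<^sub>R (\<lambda>(s, t). K s t) z) \<in> borel_measurable borel"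
    by (intro borel_measurable_continuous_on_indicator assms borel_closed closed_Times) auto
  have pair: "(\<lambda>z. (fst z, snd z)) \<in> half_line \<Otimes>\<^sub>M half_line \<rightarrow>\<^sub>M borel"
  proof -
    have id: "(\<lambda>x. x) \<in> half_line \<rightarrow>\<^sub>M borel"
      by (intro measurable_restrict_space1 measurable_completion) auto
    show ?thesis
      unfolding borel_prod[symmetric]
      by (intro measurable_Pair measurable_compose[OF measurable_fst id]
          measurable_compose[OF measurable_snd id])
  qed
  have "(\<lambda>z. indicator ({0..} \<times> {0..}) z *\<^sub>R (\<lambda>(s, t). K s t) z)
      \<in> borel_measurable (half_line \<Otimes>\<^sub>M half_line)"
    using measurable_compose[OF pair k] by (simp only: prod.collapse)
  then have K: "(\<lambda>z. (\<lambda>(s, t). K s t) z) \<in> borel_measurable (half_line \<Otimes>\<^sub>M half_line)"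
    by (rule measurable_cong[THEN iffD1, rotated])
      (auto simp: space_pair_measure space_restrict_space)
  have "ind a b \<in> borel_measurable lebesgue"
    by (intro measurable_completion) auto
  then have "ind a b \<in> borel_measurable half_line"
    by (rule measurable_restrict_space1)
  then have "(\<lambda>z. ind a b (fst z)) \<in> borel_measurable (half_line \<Otimes>\<^sub>M half_line)"
    by (rule measurable_compose[OF measurable_fst])
  then show ?thesis
    using borel_measurable_times[OF _ K, of "\<lambda>z. ind a b (fst z)"] by (simp add: case_prod_unfold)
qed

section \<open>Indicators of intervals in the domain of the adjoint\<close>

context
  fixes K :: kernel and T :: op_L2 and a b :: real
  assumes K0: "K0_kernel K T" and a: "0 \<le> a"
begin

lemma ind_kernel_measurable [measurable]:
  "(\<lambda>(x, t). ind a b x * K x t) \<in> borel_measurable (half_line \<Otimes>\<^sub>M half_line)"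
  by (rule kernel_borel_measurable[OF K0_kernelD(2)[OF K0]])

text \<open>Integrating out \<open>t\<close> leaves the squared norm of the Carleman function, which
  is continuous in \<open>x\<close> and so integrable over \<open>{a..b}\<close>.\<close>

lemma ind_kernel_square_integrable:
  "integrable (half_line \<Otimes>\<^sub>M half_line) (\<lambda>(x, t). (cmod (ind a b x * K x t))\<^sup>2)"
proof (rule half_line_pair.Fubini_integrable)
  show "(\<lambda>(x, t). (cmod (ind a b x * K x t))\<^sup>2) \<in> borel_measurable (half_line \<Otimes>\<^sub>M half_line)"
    using borel_measurable_power[OF measurable_compose[OF ind_kernel_measurable borel_measurable_norm], of 2]
    by (simp add: case_prod_unfold)
  have eq: "(LINT t|half_line. norm (case (x, t) of (x, t) \<Rightarrow> (cmod (ind a b x * K x t))\<^sup>2)) =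
      indicator {a..b} x *\<^sub>R (norm (carleman_fun K x))\<^sup>2" for x
    using norm_carleman_fun[OF K0, of x] a by (auto simp: indicator_def)
  show "integrable half_line
      (\<lambda>x. LINT t|half_line. norm (case (x, t) of (x, t) \<Rightarrow> (cmod (ind a b x * K x t))\<^sup>2))"
    unfolding eq by (intro integrable_indicator_continuous continuous_intros K0_kernelD(5)[OF K0] a)
  have "integrable half_line (\<lambda>t. (cmod (ind a b x * K x t))\<^sup>2)" if "0 \<le> x" for x
    using sq_integrable_mult_left[OF K0_kernelD(3)[OF K0 that]] by (simp add: sq_integrable_def)
  then show "AE x in half_line. integrable half_line
      (\<lambda>t. case (x, t) of (x, t) \<Rightarrow> (cmod (ind a b x * K x t))\<^sup>2)"
    by (intro AE_I2) (auto simp: space_restrict_space)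
qed

lemma ind_times_integrable:
  assumes "sq_integrable f"
  shows "integrable (half_line \<Otimes>\<^sub>M half_line) (\<lambda>(x, t). (cmod (ind a b x * f t))\<^sup>2)"
proof (rule half_line_pair.Fubini_integrable)
  have f: "f \<in> borel_measurable half_line" and f2: "integrable half_line (\<lambda>t. (cmod (f t))\<^sup>2)"
    using assms by (auto simp: sq_integrable_def)
  have i: "ind a b \<in> borel_measurable half_line"
    using sq_integrable_ind[OF a] by (simp add: sq_integrable_def)
  have "(\<lambda>z. ind a b (fst z) * f (snd z)) \<in> borel_measurable (half_line \<Otimes>\<^sub>M half_line)"
    by (intro borel_measurable_times measurable_compose[OF measurable_fst i]
        measurable_compose[OF measurable_snd f])
  then show "(\<lambda>(x, t). (cmod (ind a b x * f t))\<^sup>2) \<in> borel_measurable (half_line \<Otimes>\<^sub>M half_line)"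
    using borel_measurable_power[OF measurable_compose[OF _ borel_measurable_norm], of _ _ 2]
    by (simp add: case_prod_unfold)
  have eq: "(LINT t|half_line. norm (case (x, t) of (x, t) \<Rightarrow> (cmod (ind a b x * f t))\<^sup>2)) =
      indicator {a..b} x *\<^sub>R (LINT t|half_line. (cmod (f t))\<^sup>2)" for x
    by (auto simp: indicator_def)
  show "integrable half_line
      (\<lambda>x. LINT t|half_line. norm (case (x, t) of (x, t) \<Rightarrow> (cmod (ind a b x * f t))\<^sup>2))"
    unfolding eq by (intro integrable_indicator_continuous continuous_intros a)
  show "AE x in half_line. integrable half_line
      (\<lambda>t. case (x, t) of (x, t) \<Rightarrow> (cmod (ind a b x * f t))\<^sup>2)"
    using f2 by (intro AE_I2) (simp add: norm_mult power_mult_distrib)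
qed

text \<open>An indicator equals its square, so the integrand is a product of two square integrable
  functions, each carrying the indicator. This justifies the exchange of integrals below.\<close>

lemma ind_kernel_times_integrable:
  assumes "sq_integrable f"
  shows "integrable (half_line \<Otimes>\<^sub>M half_line) (\<lambda>(x, t). ind a b x * (K x t * f t))"
proof (rule Bochner_Integration.integrable_bound)
  show "integrable (half_line \<Otimes>\<^sub>M half_line)
      (\<lambda>z. (\<lambda>(x, t). (cmod (ind a b x * K x t))\<^sup>2) z + (\<lambda>(x, t). (cmod (ind a b x * f t))\<^sup>2) z)"
    by (intro Bochner_Integration.integrable_add ind_kernel_square_integrable ind_times_integrable assms)
  have f: "f \<in> borel_measurable half_line"
    using assms by (auto simp: sq_integrable_def)
  have "(\<lambda>z. (\<lambda>(x, t). ind a b x * K x t) z * f (snd z)) \<in> borel_measurable (half_line \<Otimes>\<^sub>M half_line)"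
    by (intro borel_measurable_times ind_kernel_measurable measurable_compose[OF measurable_snd f])
  then show "(\<lambda>(x, t). ind a b x * (K x t * f t)) \<in> borel_measurable (half_line \<Otimes>\<^sub>M half_line)"
    by (simp add: case_prod_unfold mult.assoc)
  have "cmod (y * w) \<le> (cmod y)\<^sup>2 + (cmod w)\<^sup>2" for y w
  proof -
    have "0 \<le> cmod y * cmod w" by simp
    then show ?thesis
      using sum_squares_bound[of "cmod y" "cmod w"] by (simp only: norm_mult)
  qed
  then have "cmod (ind a b x * (K x t * f t)) \<le>
      norm ((cmod (ind a b x * K x t))\<^sup>2 + (cmod (ind a b x * f t))\<^sup>2)" for x t
    by (auto simp: indicator_def)
  then show "AE z in half_line \<Otimes>\<^sub>M half_line. norm (case z of (x, t) \<Rightarrow> ind a b x * (K x t * f t)) \<le>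
      norm ((\<lambda>(x, t). (cmod (ind a b x * K x t))\<^sup>2) z + (\<lambda>(x, t). (cmod (ind a b x * f t))\<^sup>2) z)"
    by (intro AE_I2) (auto simp: case_prod_unfold)
qed

text \<open>Cauchy-Schwarz in \<open>x\<close> for each \<open>t\<close>, followed by integration in
  \<open>t\<close>. The conjugate of this function is the value of the adjoint at the
  indicator.\<close>

lemma ind_mean_kernel_sq_integrable: "sq_integrable (\<lambda>t. LINT x|half_line. ind a b x * K x t)"
proof -
  let ?v = "\<lambda>t. LINT x|half_line. ind a b x * K x t"
  have meas: "?v \<in> borel_measurable half_line"
  proof (rule half_line.borel_measurable_lebesgue_integral)
    show "(\<lambda>(t, x). ind a b x * K x t) \<in> borel_measurable (half_line \<Otimes>\<^sub>M half_line)"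
      using measurable_pair_swap[OF ind_kernel_measurable] by simp
  qed
  have int: "integrable half_line
      (\<lambda>t. (norm (abs_L2 (ind a b)))\<^sup>2 * (LINT x|half_line. (cmod (ind a b x * K x t))\<^sup>2))"
    by (intro integrable_mult_right half_line_pair.integrable_snd ind_kernel_square_integrable)
  have le: "(cmod (?v t))\<^sup>2 \<le>
      (norm (abs_L2 (ind a b)))\<^sup>2 * (LINT x|half_line. (cmod (ind a b x * K x t))\<^sup>2)" if "0 \<le> t" for t
  proof -
    let ?g = "\<lambda>x. cnj (ind a b x * K x t)"
    have "ind a b \<in> borel_measurable half_line"
      using sq_integrable_ind[OF a] by (simp add: sq_integrable_def)
    then have "sq_integrable (\<lambda>x. ind a b x * K x t)"
      using K0_kernelD(4)[OF K0 that] unfolding sq_integrable_def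
      by (auto intro: Bochner_Integration.integrable_bound[of half_line "\<lambda>x. (cmod (K x t))\<^sup>2"]
          simp: indicator_def)
    then have g: "sq_integrable ?g" by (rule sq_integrable_cnj)
    have "?v t = cinner (abs_L2 (ind a b)) (abs_L2 ?g)"
      unfolding cinner_abs_L2[OF sq_integrable_ind[OF a] g]
      by (intro Bochner_Integration.integral_cong) (auto simp: indicator_def)
    then have "cmod (?v t) \<le> norm (abs_L2 (ind a b)) * norm (abs_L2 ?g)"
      by (simp add: cinner_Cauchy_Schwarz)
    then have "(cmod (?v t))\<^sup>2 \<le> (norm (abs_L2 (ind a b)))\<^sup>2 * (norm (abs_L2 ?g))\<^sup>2"
      unfolding power_mult_distrib[symmetric] by (intro power_mono) auto
    then show ?thesis
      unfolding norm_abs_L2[OF g] complex_mod_cnj .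
  qed
  have "integrable half_line (\<lambda>t. (cmod (?v t))\<^sup>2)"
  proof (rule Bochner_Integration.integrable_bound[OF int])
    show "(\<lambda>t. (cmod (?v t))\<^sup>2) \<in> borel_measurable half_line"
      by (intro borel_measurable_power measurable_compose[OF meas borel_measurable_norm])
    show "AE t in half_line. norm ((cmod (?v t))\<^sup>2) \<le>
      norm ((norm (abs_L2 (ind a b)))\<^sup>2 * (LINT x|half_line. (cmod (ind a b x * K x t))\<^sup>2))"
      using le by (intro AE_I2) (auto simp: space_restrict_space intro: order_trans[OF _ abs_ge_self])
  qed
  with meas show ?thesis by (simp add: sq_integrable_def)
qed

lemma cinner_op_ind:
  assumes "T f = Some u"
  shows "cinner u (abs_L2 (ind a b)) =
    (LINT x|half_line. ind a b x * (LINT t|half_line. K x t * rep_L2 f t))"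
proof -
  have "cinner u (abs_L2 (ind a b)) = (LINT x|half_line. rep_L2 u x * cnj (ind a b x))"
    by (rule cinner_abs_L2_right[OF sq_integrable_ind[OF a]])
  also have "\<dots> = (LINT x|half_line. ind a b x * (LINT t|half_line. K x t * rep_L2 f t))"
  proof (rule integral_cong_AE)
    show "(\<lambda>x. rep_L2 u x * cnj (ind a b x)) \<in> borel_measurable half_line"
      by (intro borel_measurable_integrable integrable_mult_cnj sq_integrable_rep_L2 sq_integrable_ind a)
    have "(\<lambda>x. LINT t|half_line. ind a b x * (K x t * rep_L2 f t)) \<in> borel_measurable half_line"
      using ind_kernel_times_integrable[OF sq_integrable_rep_L2]
      by (intro half_line.borel_measurable_lebesgue_integral) auto
    then show "(\<lambda>x. ind a b x * (LINT t|half_line. K x t * rep_L2 f t)) \<in> borel_measurable half_line"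
      by simp
    show "AE x in half_line. rep_L2 u x * cnj (ind a b x) =
        ind a b x * (LINT t|half_line. K x t * rep_L2 f t)"
      using K0_kernelD(7)[OF K0 assms] by eventually_elim (simp add: indicator_def)
  qed
  finally show ?thesis .
qed

text \<open>Fubini's theorem moves the integration over \<open>{a..b}\<close> from the image
  \<open>u\<close> onto the kernel, which exhibits the vector required of the adjoint.\<close>

lemma ind_in_dom_adjoint: "abs_L2 (ind a b) \<in> dom (adjoint_op T)"
proof -
  let ?v = "\<lambda>t. LINT x|half_line. ind a b x * K x t"
  have v: "sq_integrable (\<lambda>t. cnj (?v t))"
    by (intro sq_integrable_cnj ind_mean_kernel_sq_integrable)
  have "cinner u (abs_L2 (ind a b)) = cinner f (abs_L2 (\<lambda>t. cnj (?v t)))" if "T f = Some u" for f u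
  proof -
    have "cinner u (abs_L2 (ind a b)) =
        (LINT x|half_line. LINT t|half_line. ind a b x * (K x t * rep_L2 f t))"
      using cinner_op_ind[OF that] by simp
    also have "\<dots> = (LINT t|half_line. LINT x|half_line. ind a b x * (K x t * rep_L2 f t))"
      by (rule half_line_pair.Fubini_integral[symmetric])
        (rule ind_kernel_times_integrable[OF sq_integrable_rep_L2])
    also have "\<dots> = (LINT t|half_line. rep_L2 f t * ?v t)"
    proof -
      have "ind a b x * (K x t * rep_L2 f t) = rep_L2 f t * (ind a b x * K x t)" for x t
        by (simp add: mult_ac)
      then show ?thesis by (simp only: integral_mult_right_zero)
    qed
    also have "\<dots> = cinner f (abs_L2 (\<lambda>t. cnj (?v t)))"
      using cinner_abs_L2_right[OF v] by simp
    finally show ?thesis .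
  qed
  then show ?thesis
    using adjoint_opI[OF K0_kernelD(6)[OF K0]] by blast
qed

lemma cinner_op_ind_ind:
  assumes "T (abs_L2 (ind c d)) = Some u" "0 \<le> c"
  shows "cinner u (abs_L2 (ind a b)) = integral {a..b} (\<lambda>s. integral {c..d} (K s))"
proof -
  \<comment> \<open>The representative chosen by \<open>rep_L2\<close> need not be the indicator
    itself, so the integral is read as a pairing with the Carleman function, which depends on the
    class only.\<close>
  have inner: "(LINT t|half_line. K s t * rep_L2 (abs_L2 (ind c d)) t) = integral {c..d} (K s)"
    if "0 \<le> s" for s
  proof -
    have "cinner (abs_L2 (ind c d)) (carleman_fun K s) =
        cnj (cinner (abs_L2 (\<lambda>t. cnj (K s t))) (abs_L2 (ind c d)))"
      unfolding carleman_fun_def by (rule cinner_commute)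
    also have "\<dots> = cnj (integral {c..d} (\<lambda>t. cnj (K s t)))"
      using cinner_ind[OF sq_integrable_cnj[OF K0_kernelD(3)[OF K0 that]] assms(2)] by simp
    also have "\<dots> = integral {c..d} (K s)"
      by (simp add: integral_cnj)
    finally show ?thesis
      by (simp add: cinner_carleman_fun[OF K0 that])
  qed
  have cont: "continuous_on {0..} (\<lambda>s. integral {c..d} (K s))"
    unfolding cbox_interval[symmetric]
    by (intro integral_continuous_on_param continuous_on_subset[OF K0_kernelD(2)[OF K0]])
      (use assms in auto)
  have "cinner u (abs_L2 (ind a b)) = (LINT x|half_line. ind a b x * integral {c..d} (K x))"
    unfolding cinner_op_ind[OF assms(1)]
    by (intro Bochner_Integration.integral_cong) (auto simp: inner space_restrict_space)
  also have "\<dots> = integral {a..b} (\<lambda>s. integral {c..d} (K s))"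
  proof (rule LINT_ind[OF _ a])
    have "(\<lambda>x. ind a b x * integral {c..d} (K x)) = (\<lambda>x. indicator {a..b} x *\<^sub>R integral {c..d} (K x))"
      by (auto simp: indicator_def)
    then show "integrable half_line (\<lambda>x. ind a b x * integral {c..d} (K x))"
      using integrable_indicator_continuous[OF cont a] by simp
  qed
  finally show ?thesis .
qed

end

section \<open>Continuous representatives and eigenvectors\<close>

lemma integral_op_representative:
  assumes K0: "K0_kernel K T" and f: "T f = Some u"
  defines "g \<equiv> \<lambda>s. if 0 \<le> s then cinner f (carleman_fun K s) else 0"
  shows "continuous_on {0..} g" "sq_integrable g" "u = abs_L2 g"
proof -
  \<comment> \<open>Norm continuity of the Carleman function is what makes every vector in the range
    of the operator have a continuous representative.\<close>
  have "continuous_on {0..} (\<lambda>s. cinner f (carleman_fun K s))"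
    by (intro bounded_linear.continuous_on[OF bounded_linear_cinner_right] K0_kernelD(5)[OF K0])
  then show cont: "continuous_on {0..} g"
    by (rule continuous_on_eq) (simp add: g_def)
  have AE: "AE s in half_line. rep_L2 u s = g s"
    using K0_kernelD(7)[OF K0 f] AE_space
    by eventually_elim (simp add: g_def cinner_carleman_fun[OF K0] space_restrict_space)
  have u: "rep_L2 u \<in> borel_measurable half_line" "integrable half_line (\<lambda>s. (cmod (rep_L2 u s))\<^sup>2)"
    using sq_integrable_rep_L2[of u] by (auto simp: sq_integrable_def)
  have meas: "g \<in> borel_measurable half_line"
    by (rule continuous_imp_measurable_on_sets_lebesgue[OF cont]) auto
  have "integrable half_line (\<lambda>s. (cmod (g s))\<^sup>2)"
  proof (rule integrable_cong_AE[THEN iffD1, OF _ _ _ u(2)])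
    show "(\<lambda>s. (cmod (rep_L2 u s))\<^sup>2) \<in> borel_measurable half_line"
      using u(2) by (rule borel_measurable_integrable)
    show "(\<lambda>s. (cmod (g s))\<^sup>2) \<in> borel_measurable half_line"
      by (intro borel_measurable_power measurable_compose[OF meas borel_measurable_norm])
    show "AE s in half_line. (cmod (rep_L2 u s))\<^sup>2 = (cmod (g s))\<^sup>2"
      using AE by eventually_elim simp
  qed
  with meas show g: "sq_integrable g" by (simp add: sq_integrable_def)
  have "abs_L2 (rep_L2 u) = abs_L2 g"
    by (intro abs_L2_eqI sq_integrable_rep_L2 g AE)
  then show "u = abs_L2 g" by (simp add: abs_rep_L2)
qed

text \<open>Representatives of one class have equal integrals over bounded intervals, by pairing
  with indicators. For continuous functions this forces equality on the half-line, and off it both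
  are normalised to 0.\<close>

lemma cont_rep_eqI:
  assumes g: "sq_integrable g" "abs_L2 g = f" "continuous_on {0..} g" "\<And>x. x < 0 \<Longrightarrow> g x = 0"
  shows "cont_rep f = g"
  unfolding cont_rep_def
proof (rule the_equality)
  show "sq_integrable g \<and> abs_L2 g = f \<and> continuous_on {0..} g \<and> (\<forall>x<0. g x = 0)"
    using g by auto
  fix h assume h: "sq_integrable h \<and> abs_L2 h = f \<and> continuous_on {0..} h \<and> (\<forall>x<0. h x = 0)"
  have "h x - g x = 0" if "0 \<le> x" for x
  proof (rule continuous_zero_if_integrals_zero[OF _ _ that])
    show "continuous_on {0..} (\<lambda>x. h x - g x)"
      using g h by (intro continuous_intros) auto
    fix a b :: real assume a: "0 \<le> a"
    have "h integrable_on {a..b}" "g integrable_on {a..b}"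
      using a g h by (auto intro!: integrable_continuous_interval intro: continuous_on_subset[of "{0..}"])
    then show "integral {a..b} (\<lambda>x. h x - g x) = 0"
      using integral_eq_if_abs_L2_eq[of h g a b] a g h by (simp add: integral_diff)
  qed
  then have "h x = g x" for x
    using g h by (cases "0 \<le> x") auto
  then show "h = g" by auto
qed

text \<open>A nonzero eigenvalue puts \<open>f\<close> in the range of \<open>T\<close>, so
  \<open>f\<close> inherits the continuous representative of \<open>T f\<close> divided by
  \<open>c\<close>.\<close>

lemma cont_rep_eigenvector:
  assumes K0: "K0_kernel K T" and f: "T f = Some (c *\<^sub>C f)" and c: "c \<noteq> 0"
  shows "continuous_on {0..} (cont_rep f)" "sq_integrable (cont_rep f)" "abs_L2 (cont_rep f) = f"
proof -
  define g where "g = (\<lambda>s. if 0 \<le> s then cinner f (carleman_fun K s) else 0)"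
  define h where "h = (\<lambda>s. inverse c * g s)"
  note g = integral_op_representative[OF K0 f, folded g_def]
  have h: "continuous_on {0..} h" "sq_integrable h"
    unfolding h_def by (intro continuous_intros sq_integrable_mult_left g)+
  have "abs_L2 h = inverse c *\<^sub>C abs_L2 g"
    unfolding h_def by (rule scaleC_abs_L2[symmetric, OF g(2)])
  also have "\<dots> = f"
    using c by (simp add: g(3)[symmetric] scaleC_scaleC scaleC_one)
  finally have "abs_L2 h = f" .
  moreover from this have "cont_rep f = h"
    by (intro cont_rep_eqI h) (auto simp: h_def g_def)
  ultimately show "continuous_on {0..} (cont_rep f)" "sq_integrable (cont_rep f)"
    "abs_L2 (cont_rep f) = f"
    using h by auto
qed

text \<open>The diagonal form speaks only of vectors already known to be in the domain. Membership
  of \<open>\<phi> k\<close> is therefore obtained through the adjoint, and only then does the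
  series at \<open>\<phi> k\<close> collapse to one term.\<close>

lemma normal_diagonal_eigenvector:
  assumes N: "normal_op N" and orth: "orthonormal \<phi>"
    and diag: "\<And>f u. N f = Some u \<Longrightarrow> (\<lambda>n. (\<alpha> n * cinner f (\<phi> n)) *\<^sub>C \<phi> n) sums u"
  shows "N (\<phi> k) = Some (\<alpha> k *\<^sub>C \<phi> k)"
proof -
  have delta: "cinner (\<phi> m) (\<phi> n) = (if m = n then 1 else 0)" for m n
    using orth by (simp add: orthonormal_def)
  have "adjoint_op N (\<phi> k) = Some (cnj (\<alpha> k) *\<^sub>C \<phi> k)"
  proof (rule adjoint_opI)
    show "densely_defined N" using N by (simp add: normal_op_def)
    fix f u assume "N f = Some u"
    then have "(\<lambda>n. cinner ((\<alpha> n * cinner f (\<phi> n)) *\<^sub>C \<phi> n) (\<phi> k)) sums cinner u (\<phi> k)"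
      by (intro bounded_linear.sums[OF bounded_linear_cinner_left] diag)
    moreover have "(\<lambda>n. cinner ((\<alpha> n * cinner f (\<phi> n)) *\<^sub>C \<phi> n) (\<phi> k)) =
        (\<lambda>n. if n = k then \<alpha> k * cinner f (\<phi> k) else 0)"
      by (auto simp: cinner_scaleC_left delta)
    ultimately have "cinner u (\<phi> k) = \<alpha> k * cinner f (\<phi> k)"
      using sums_single[of k "\<lambda>n. \<alpha> n * cinner f (\<phi> n)"] by (auto intro: sums_unique2 cong: if_cong)
    then show "cinner u (\<phi> k) = cinner f (cnj (\<alpha> k) *\<^sub>C \<phi> k)"
      by (simp add: cinner_scaleC_right)
  qed
  then have "\<phi> k \<in> dom N"
    using N by (auto simp: normal_op_def)
  then obtain u where u: "N (\<phi> k) = Some u" by auto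
  \<comment> \<open>The terms with complex factor 0 vanish because they are real multiples by
    0.\<close>
  have "(\<lambda>n. (\<alpha> n * cinner (\<phi> k) (\<phi> n)) *\<^sub>C \<phi> n) = (\<lambda>n. if n = k then \<alpha> n *\<^sub>C \<phi> n else 0)"
    using scaleR_zero_left[of "\<phi> _"] by (auto simp: delta scaleR_L2_def)
  then have "(\<lambda>n. if n = k then \<alpha> n *\<^sub>C \<phi> n else 0) sums u"
    using diag[OF u] by simp
  then have "u = \<alpha> k *\<^sub>C \<phi> k"
    using sums_single[of k "\<lambda>n. \<alpha> n *\<^sub>C \<phi> n"] by (rule sums_unique2)
  then show ?thesis using u by simp
qed

text \<open>Turning the bisector onto the positive real axis leaves arguments of size at most half
  the opening angle, which is below \<open>pi / 2\<close>; its cosine is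
  \<open>\<kappa>\<close>.\<close>

lemma sector_rotation:
  assumes "\<theta>\<^sub>2 - \<theta>\<^sub>1 < pi"
  obtains \<omega> \<kappa> where "cmod \<omega> = 1" "0 < \<kappa>"
    "\<And>z. z \<in> sector \<theta>\<^sub>1 \<theta>\<^sub>2 \<Longrightarrow> \<kappa> * cmod z \<le> Re (\<omega> * z)"
proof (cases "\<theta>\<^sub>1 \<le> \<theta>\<^sub>2")
  case True
  define \<mu> where "\<mu> = (\<theta>\<^sub>1 + \<theta>\<^sub>2) / 2"
  define \<eta> where "\<eta> = (\<theta>\<^sub>2 - \<theta>\<^sub>1) / 2"
  have \<eta>: "0 \<le> \<eta>" "\<eta> < pi / 2" using True assms by (auto simp: \<eta>_def)
  have "cos \<eta> * cmod z \<le> Re (cis (- \<mu>) * z)" if z: "z \<in> sector \<theta>\<^sub>1 \<theta>\<^sub>2" for z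
  proof -
    obtain \<rho> \<theta> where \<theta>: "0 \<le> \<rho>" "\<theta>\<^sub>1 \<le> \<theta>" "\<theta> \<le> \<theta>\<^sub>2" "z = of_real \<rho> * cis \<theta>"
      using z by (auto simp: sector_def)
    have abs: "\<bar>\<theta> - \<mu>\<bar> \<le> \<eta>"
      using \<theta> by (auto simp: \<mu>_def \<eta>_def abs_le_iff field_simps)
    then have "cos \<eta> \<le> cos \<bar>\<theta> - \<mu>\<bar>"
      using \<eta> by (intro cos_monotone_0_pi_le) auto
    then have "\<rho> * cos \<eta> \<le> \<rho> * cos (\<theta> - \<mu>)"
      using \<theta>(1) by (intro mult_left_mono) (auto simp: cos_abs_real)
    moreover have "cis (- \<mu>) * z = of_real \<rho> * cis (\<theta> - \<mu>)"
      by (simp add: \<theta>(4) cis_mult mult.left_commute)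
    moreover have "cmod z = \<rho>"
      using \<theta>(1,4) by (simp add: norm_mult)
    ultimately show ?thesis
      by (simp add: mult.commute)
  qed
  moreover have "0 < cos \<eta>"
    using \<eta> by (intro cos_gt_zero_pi) auto
  ultimately show ?thesis
    by (intro that[of "cis (- \<mu>)" "cos \<eta>"]) auto
next
  \<comment> \<open>The sector is empty, so any constants serve.\<close>
  case False
  then show ?thesis
    by (intro that[of 1 1]) (auto simp: sector_def)
qed

subsection \<open>The bilinear series\<close>

theorem theorem2:
  fixes N :: op_L2 and K :: kernel
    and \<alpha> :: "nat \<Rightarrow> complex" and \<phi> :: "nat \<Rightarrow> L2" and \<theta>\<^sub>1 \<theta>\<^sub>2 :: real
  assumes "normal_op N"
    and "K0_kernel K N"
    and "orthonormal \<phi>"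
    and "\<theta>\<^sub>2 - \<theta>\<^sub>1 < pi"
    and "\<And>n. \<alpha> n \<in> sector \<theta>\<^sub>1 \<theta>\<^sub>2"
    and "\<And>f u. N f = Some u \<Longrightarrow> (\<lambda>n. (\<alpha> n * cinner f (\<phi> n)) *\<^sub>C \<phi> n) sums u"
  shows "(\<forall>s\<ge>0. \<forall>t\<ge>0.
            summable (\<lambda>n. cmod (\<alpha> n * cont_rep (\<phi> n) s * cnj (cont_rep (\<phi> n) t)))) \<and>
         uniform_limit ({0..} \<times> {0..})
           (\<lambda>m (s, t). \<Sum>n<m. \<alpha> n * cont_rep (\<phi> n) s * cnj (cont_rep (\<phi> n) t))
           (\<lambda>(s, t). K s t) sequentially"
proof -
  note N = assms(1) and K0 = assms(2)
  obtain \<omega> \<kappa> where \<omega>: "cmod \<omega> = 1" and \<kappa>: "0 < \<kappa>"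
    and sec: "\<And>z. z \<in> sector \<theta>\<^sub>1 \<theta>\<^sub>2 \<Longrightarrow> \<kappa> * cmod z \<le> Re (\<omega> * z)"
    using sector_rotation[OF assms(4)] by metis
  \<comment> \<open>If \<open>\<alpha> n = 0\<close>, the class \<open>\<phi> n\<close> may have no
    continuous representative and \<open>cont_rep\<close> is then unspecified. Replacing it by 0
    restores continuity and changes no term of the series.\<close>
  define \<psi> where "\<psi> n = (if \<alpha> n = 0 then \<lambda>_. 0 else cont_rep (\<phi> n))" for n
  have eig: "N (\<phi> n) = Some (\<alpha> n *\<^sub>C \<phi> n)" for n
    by (rule normal_diagonal_eigenvector[OF N assms(3,6)])
  have psi: "sq_integrable (\<psi> n)" "abs_L2 (\<psi> n) = \<phi> n" if "\<alpha> n \<noteq> 0" for n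
    using cont_rep_eigenvector[OF K0 eig that] that by (simp_all add: \<psi>_def)
  interpret sectorial_expansion K \<psi> \<alpha> \<omega> \<kappa>
  proof
    show "(\<lambda>(s, t). K s t) \<in> C0 ({0..} \<times> {0..})"
      by (rule K0_kernelD(1)[OF K0])
    show "continuous_on {0..} (\<psi> n)" for n
      using cont_rep_eigenvector(1)[OF K0 eig, of n] by (simp add: \<psi>_def)
    show "\<kappa> * cmod (\<alpha> n) \<le> Re (\<omega> * \<alpha> n)" for n
      by (intro sec assms(5))
    fix a b c d :: real assume a: "0 \<le> a" and c: "0 \<le> c"
    \<comment> \<open>Normality identifies the domain of \<open>N\<close> with that of its adjoint,
      so the diagonal form applies to this indicator; pairing the result with the indicator of
      \<open>{a..b}\<close> gives the rectangle expansion.\<close>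
    have "abs_L2 (ind c d) \<in> dom N"
      using ind_in_dom_adjoint[OF K0 c] N by (simp add: normal_op_def)
    then obtain u where u: "N (abs_L2 (ind c d)) = Some u" by auto
    have "(\<lambda>n. cinner ((\<alpha> n * cinner (abs_L2 (ind c d)) (\<phi> n)) *\<^sub>C \<phi> n) (abs_L2 (ind a b))) sums
        cinner u (abs_L2 (ind a b))"
      by (intro bounded_linear.sums[OF bounded_linear_cinner_left] assms(6) u)
    moreover have "cinner ((\<alpha> n * cinner (abs_L2 (ind c d)) (\<phi> n)) *\<^sub>C \<phi> n) (abs_L2 (ind a b)) =
        \<alpha> n * integral {a..b} (\<psi> n) * cnj (integral {c..d} (\<psi> n))" for n
    proof (cases "\<alpha> n = 0")
      case False
      have "cinner (\<phi> n) (abs_L2 (ind a b)) = integral {a..b} (\<psi> n)"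
        using cinner_ind[OF psi(1)[OF False] a] psi(2)[OF False] by simp
      moreover have "cinner (\<phi> n) (abs_L2 (ind c d)) = integral {c..d} (\<psi> n)"
        using cinner_ind[OF psi(1)[OF False] c] psi(2)[OF False] by simp
      then have "cinner (abs_L2 (ind c d)) (\<phi> n) = cnj (integral {c..d} (\<psi> n))"
        by (subst cinner_commute) simp
      ultimately show ?thesis
        by (simp add: cinner_scaleC_left mult_ac)
    qed (simp add: cinner_scaleC_left)
    ultimately show "(\<lambda>n. \<alpha> n * integral {a..b} (\<psi> n) * cnj (integral {c..d} (\<psi> n))) sums
        integral {a..b} (\<lambda>s. integral {c..d} (K s))"
      using cinner_op_ind_ind[OF K0 a u c] by simp
  qed (rule \<omega> \<kappa>)+
  have bilinear_term: "bilinear_term n s t = \<alpha> n * cont_rep (\<phi> n) s * cnj (cont_rep (\<phi> n) t)" for n s t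
    by (simp add: bilinear_term_def \<psi>_def)
  show ?thesis
    using summable_cmod_bilinear_term uniform_limit_partial_kernel_K unfolding partial_kernel_def bilinear_term by blast
qed

end
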